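(* Let $K$ be a field, let $H$ be a subgroup of $\mathrm{GL}_3(K)$ with $\mathrm{E}_3(K)\leq H\leq \mathrm{GL}_3(K)$, and let $T$ be the $H$-class of $t_{12}(1)\in \mathrm{GL}_3(K)$. Let $C$ be a noncentral $H$-class. Then the following holds. (i) If $C=T$, then $m(C)=1$. (ii) If $C\neq T$ and $\chi_C$ has a root in $K$, then $m(C)=2$. In this case $T\subseteq CC^{-1}$. (iii) If $C\neq T$, $\chi_C$ has no root in $K$ and $\det(C)^2=1$, then $m(C)=2$. In this case $T\subseteq CC$. (iv) If $C\neq T$, $\chi_C$ has no root in $K$, $\det(C)^2\neq 1$ and $\det(C)^3=1$, then $m(C)=3$. In this case $T\subseteq CCC$. (v) If $C\neq T$, $\chi_C$ has no root in $K$, $\det(C)^2\neq 1$ and $\det(C)^3\neq 1$, then $m(C)=4$. In this case $T\subseteq CC^{-1}CC^{-1}$.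
   Context: $t_{ij}(a)=e+ae^{ij}$ ($i\neq j$, $a\in K$) is an elementary transvection, where $e$ is the identity matrix and $e^{ij}$ the matrix unit; $\mathrm{E}_3(K)$ is the subgroup of $\mathrm{GL}_3(K)$ generated by all elementary transvections. For $g\in \mathrm{GL}_3(K)$, the $H$-class of $g$ is $g^H=\{h^{-1}gh\mid h\in H\}$ ($g$ need not lie in $H$); it is noncentral if $g$ is not in the center of $\mathrm{GL}_3(K)$. If $C=g^H$, then $C^{1}:=C$, $C^{-1}:=(g^{-1})^H$, $\chi_C:=\chi_g=\det(Xe-g)\in K[X]$ is the characteristic polynomial and $\det(C):=\det(g)$. Products of classes are elementwise products of sets. For a noncentral $H$-class $C$, $m(C)$ is the minimal positive integer $m$ such that there exist $i_1,\dots,i_m\in\{\pm1\}$ with $T\subseteq C^{i_1}\cdots C^{i_m}$. *)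

theory Defs
  imports
    "HOL-Analysis.Determinants"
    "HOL-Algebra.Generated_Groups"
    "HOL-Computational_Algebra.Polynomial"
begin

definition GL3 :: "('k::field^3^3) monoid" where
  "GL3 = \<lparr>carrier = {A. invertible A}, mult = (**), one = mat 1\<rparr>"

definition matrix_unit :: "3 \<Rightarrow> 3 \<Rightarrow> 'k::field^3^3" where
  "matrix_unit i j = (\<chi> r s. if r = i \<and> s = j then 1 else 0)"

definition transvection :: "3 \<Rightarrow> 3 \<Rightarrow> 'k::field \<Rightarrow> 'k^3^3" where
  "transvection i j a = mat 1 + map_matrix ((*) a) (matrix_unit i j)"

definition E3 :: "('k::field^3^3) set" where
  "E3 = generate GL3 {transvection i j a | i j a. i \<noteq> j}"

definition group_center :: "('a, 'b) monoid_scheme \<Rightarrow> 'a set" where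
  "group_center G =
     {z \<in> carrier G. \<forall>x \<in> carrier G. z \<otimes>\<^bsub>G\<^esub> x = x \<otimes>\<^bsub>G\<^esub> z}"

definition conj_class :: "('k::field^3^3) set \<Rightarrow> 'k^3^3 \<Rightarrow> ('k^3^3) set" where
  "conj_class H g = {inv\<^bsub>GL3\<^esub> h \<otimes>\<^bsub>GL3\<^esub> g \<otimes>\<^bsub>GL3\<^esub> h | h. h \<in> H}"

definition charpoly :: "'k::field^3^3 \<Rightarrow> 'k poly" where
  "charpoly g = det (mat [:0, 1:] - map_matrix (\<lambda>a. [:a:]) g)"

text \<open>
  Data attached to a class \<open>C = conj_class H g\<close> (its characteristic polynomial, its determinant,
  \<open>C\<^sup>-\<^sup>1\<close> and \<open>m(C)\<close>) are expressed through a representative \<open>g\<close>. The lemmas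
  \<open>charpoly_conj_class\<close>, \<open>det_conj_class\<close>, \<open>signed_class_cong\<close> and \<open>class_m_cong\<close> show that
  they depend only on the class.
\<close>

text \<open>The class \<open>C\<^sup>i\<close>, intended for \<open>i \<in> {1, -1}\<close> only.\<close>

definition signed_class :: "('k::field^3^3) set \<Rightarrow> 'k^3^3 \<Rightarrow> int \<Rightarrow> ('k^3^3) set" where
  "signed_class H g i = (if i = 1 then conj_class H g else conj_class H (inv\<^bsub>GL3\<^esub> g))"

definition signed_class_prod ::
    "('k::field^3^3) set \<Rightarrow> 'k^3^3 \<Rightarrow> int list \<Rightarrow> ('k^3^3) set" where
  "signed_class_prod H g is =
     foldr (\<lambda>i S. signed_class H g i <#>\<^bsub>GL3\<^esub> S) is {\<one>\<^bsub>GL3\<^esub>}"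

text \<open>
  If no suitable sequence of signs exists, the value of \<open>LEAST\<close> is unspecified.
\<close>

definition class_m :: "('k::field^3^3) set \<Rightarrow> 'k^3^3 \<Rightarrow> nat" where
  "class_m H g =
     (LEAST m. m > 0 \<and>
        (\<exists>is. length is = m \<and> set is \<subseteq> {1, -1} \<and>
              conj_class H (transvection 1 2 1) \<subseteq> signed_class_prod H g is))"

lemma group_GL3: "group (GL3 :: ('k::field^3^3) monoid)"
proof (rule groupI)
  fix x :: "'k^3^3"
  assume "x \<in> carrier GL3"
  then obtain y where "x ** y = mat 1" "y ** x = mat 1"
    by (auto simp: GL3_def invertible_def)
  then show "\<exists>y\<in>carrier GL3. y \<otimes>\<^bsub>GL3\<^esub> x = \<one>\<^bsub>GL3\<^esub>"
    by (auto simp: GL3_def invertible_def)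
qed (auto simp: GL3_def invertible_mult matrix_mul_assoc invertible_def[of "mat 1"])

lemma conj_class_eqD:
  fixes H :: "('k::field^3^3) set"
  assumes "subgroup H GL3" "g \<in> carrier GL3" "conj_class H g = conj_class H g'"
  obtains h where "h \<in> H" "g = inv\<^bsub>GL3\<^esub> h \<otimes>\<^bsub>GL3\<^esub> g' \<otimes>\<^bsub>GL3\<^esub> h"
proof -
  interpret G: group "GL3 :: ('k^3^3) monoid" by (rule group_GL3)
  have "\<one>\<^bsub>GL3\<^esub> \<in> H" using assms(1) by (rule subgroup.one_closed)
  then have "g \<in> conj_class H g"
    unfolding conj_class_def using assms(2) by force
  then show ?thesis using assms(3) that by (auto simp: conj_class_def)
qed

lemma det_conj_class:
  fixes H :: "('k::field^3^3) set"
  assumes "subgroup H GL3" "g \<in> carrier GL3" "conj_class H g = conj_class H g'"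
  shows "det g = det g'"
proof -
  interpret G: group "GL3 :: ('k^3^3) monoid" by (rule group_GL3)
  obtain h where h: "h \<in> H" "g = inv\<^bsub>GL3\<^esub> h \<otimes>\<^bsub>GL3\<^esub> g' \<otimes>\<^bsub>GL3\<^esub> h"
    using conj_class_eqD[OF assms] .
  have hc: "h \<in> carrier GL3" using assms(1) h(1) by (rule subgroup.mem_carrier)
  have "inv\<^bsub>GL3\<^esub> h ** h = mat 1" using G.l_inv[OF hc] by (simp add: GL3_def)
  then have "det (inv\<^bsub>GL3\<^esub> h) * det h = 1" by (metis det_mul det_I)
  moreover have "det g = det (inv\<^bsub>GL3\<^esub> h) * det g' * det h"
    unfolding h(2) by (simp add: GL3_def det_mul)
  ultimately show ?thesis by (metis mult.assoc mult.commute mult_1)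
qed

lemma charpoly_conj_class:
  fixes H :: "('k::field^3^3) set"
  assumes "subgroup H GL3" "g \<in> carrier GL3" "conj_class H g = conj_class H g'"
  shows "charpoly g = charpoly g'"
proof -
  interpret G: group "GL3 :: ('k^3^3) monoid" by (rule group_GL3)
  let ?P = "map_matrix (\<lambda>a::'k. [:a:]) :: 'k^3^3 \<Rightarrow> 'k poly^3^3"
  let ?X = "mat [:0, 1:] :: 'k poly^3^3"
  obtain h where h: "h \<in> H" "g = inv\<^bsub>GL3\<^esub> h \<otimes>\<^bsub>GL3\<^esub> g' \<otimes>\<^bsub>GL3\<^esub> h"
    using conj_class_eqD[OF assms] .
  have hc: "h \<in> carrier GL3" using assms(1) h(1) by (rule subgroup.mem_carrier)
  let ?h' = "inv\<^bsub>GL3\<^esub> h"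
  have inv: "?h' ** h = mat 1" using G.l_inv[OF hc] by (simp add: GL3_def)
  have P_mult: "?P (A ** B) = ?P A ** ?P B" for A B
    by (simp add: vec_eq_iff matrix_matrix_mult_def sum_3)
  have P_one: "?P (mat 1) = mat 1"
    by (simp add: vec_eq_iff mat_def)
  have X_comm: "?X ** A = A ** ?X" for A
    by (simp add: vec_eq_iff matrix_matrix_mult_def mat_def sum_3 forall_3)
  have P_inv: "?P ?h' ** ?P h = mat 1" by (metis inv P_mult P_one)
  have "?X - ?P g = ?P ?h' ** (?X - ?P g') ** ?P h"
  proof -
    have "?P ?h' ** ?X ** ?P h = ?X"
      by (metis X_comm P_inv matrix_mul_assoc matrix_mul_rid)
    moreover have "?P g = ?P ?h' ** ?P g' ** ?P h"
      unfolding h(2) by (simp add: GL3_def P_mult)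
    moreover have "A ** (B - C) ** D = A ** B ** D - A ** C ** D" for A B C D :: "'k poly^3^3"
      by (simp add: vec_eq_iff matrix_matrix_mult_def sum_3 algebra_simps)
    ultimately show ?thesis by simp
  qed
  then have "charpoly g = det (?P ?h') * charpoly g' * det (?P h)"
    by (simp add: charpoly_def det_mul)
  moreover have "det (?P ?h') * det (?P h) = 1" by (metis P_inv det_mul det_I)
  ultimately show ?thesis by (metis mult.assoc mult.commute mult_1)
qed

lemma conj_class_inv_subset:
  fixes H :: "('k::field^3^3) set"
  assumes "subgroup H GL3" "g \<in> carrier GL3" "g' \<in> carrier GL3"
    and "conj_class H g = conj_class H g'"
  shows "conj_class H (inv\<^bsub>GL3\<^esub> g) \<subseteq> conj_class H (inv\<^bsub>GL3\<^esub> g')"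
proof
  interpret G: group "GL3 :: ('k^3^3) monoid" by (rule group_GL3)
  fix x assume "x \<in> conj_class H (inv\<^bsub>GL3\<^esub> g)"
  then obtain k where k: "k \<in> H" "x = inv\<^bsub>GL3\<^esub> k \<otimes>\<^bsub>GL3\<^esub> inv\<^bsub>GL3\<^esub> g \<otimes>\<^bsub>GL3\<^esub> k"
    by (auto simp: conj_class_def)
  obtain h where h: "h \<in> H" "g = inv\<^bsub>GL3\<^esub> h \<otimes>\<^bsub>GL3\<^esub> g' \<otimes>\<^bsub>GL3\<^esub> h"
    using conj_class_eqD[OF assms(1,2,4)] .
  have c: "h \<in> carrier GL3" "k \<in> carrier GL3"
    using assms(1) h(1) k(1) by (auto intro: subgroup.mem_carrier)
  have "x = inv\<^bsub>GL3\<^esub> (h \<otimes>\<^bsub>GL3\<^esub> k) \<otimes>\<^bsub>GL3\<^esub> inv\<^bsub>GL3\<^esub> g' \<otimes>\<^bsub>GL3\<^esub> (h \<otimes>\<^bsub>GL3\<^esub> k)"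
    unfolding k(2) h(2) using c assms(3) by (simp add: G.inv_mult_group G.m_assoc)
  moreover have "h \<otimes>\<^bsub>GL3\<^esub> k \<in> H" using assms(1) h(1) k(1) by (rule subgroup.m_closed)
  ultimately show "x \<in> conj_class H (inv\<^bsub>GL3\<^esub> g')" by (auto simp: conj_class_def)
qed

lemma signed_class_cong:
  fixes H :: "('k::field^3^3) set"
  assumes "subgroup H GL3" "g \<in> carrier GL3" "g' \<in> carrier GL3"
    and "conj_class H g = conj_class H g'"
  shows "signed_class H g = signed_class H g'"
  using conj_class_inv_subset[OF assms] conj_class_inv_subset[OF assms(1,3,2) assms(4)[symmetric]]
    assms(4) by (auto simp: signed_class_def fun_eq_iff)

lemma class_m_cong:
  fixes H :: "('k::field^3^3) set"
  assumes "subgroup H GL3" "g \<in> carrier GL3" "g' \<in> carrier GL3"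
    and "conj_class H g = conj_class H g'"
  shows "class_m H g = class_m H g'"
  by (simp add: class_m_def signed_class_prod_def signed_class_cong[OF assms])

end

theory Submission
  imports Defs
begin

text \<open>
  Over a field \<open>E\<^sub>3\<close> is the special linear group, so all transvections are conjugate under \<open>H\<close>
  and it suffices to find a single transvection in a conjugation-closed product.

  If \<open>g v = x v\<close>, the commutator of \<open>g\<close> with a transvection fixing \<open>v\<close> and acting by
  multiples of \<open>v\<close> (or with a dual one) is again a transvection.
  If the characteristic polynomial has no root, then \<open>g\<close> is cyclic. Multiplying \<open>g\<inverse>\<close> by a
  transvection changes it by a rank-one matrix with which one can prescribe the characteristic
  polynomial (up to the determinant), and matching cyclic frames yields conjugacy by a matrix of
  determinant 1. For \<open>C C\<inverse> C C\<inverse>\<close> one first finds a nontrivial matrix with eigenvalue 1 in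
  \<open>C C\<inverse>\<close> and applies the eigenvalue case to it. Shorter products are excluded by determinants,
  and \<open>C C\<inverse>\<close> because a matrix without eigenvalue and its product with a transvection never
  share their characteristic polynomial.
\<close>

subsection \<open>Explicit 3 by 3 matrices\<close>

definition matrix3 :: "'a \<Rightarrow> 'a \<Rightarrow> 'a \<Rightarrow> 'a \<Rightarrow> 'a \<Rightarrow> 'a \<Rightarrow> 'a \<Rightarrow> 'a \<Rightarrow> 'a \<Rightarrow> 'a::zero^3^3"
  where "matrix3 a b c d e f g h i = vector [vector [a, b, c], vector [d, e, f], vector [g, h, i]]"

lemma matrix3_nth [simp]:
  "matrix3 a b c d e f g h i $ 1 $ 1 = a" "matrix3 a b c d e f g h i $ 1 $ 2 = b"
  "matrix3 a b c d e f g h i $ 1 $ 3 = c" "matrix3 a b c d e f g h i $ 2 $ 1 = d"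
  "matrix3 a b c d e f g h i $ 2 $ 2 = e" "matrix3 a b c d e f g h i $ 2 $ 3 = f"
  "matrix3 a b c d e f g h i $ 3 $ 1 = g" "matrix3 a b c d e f g h i $ 3 $ 2 = h"
  "matrix3 a b c d e f g h i $ 3 $ 3 = i"
  by (simp_all add: matrix3_def)

lemma matrix3_eqI:
  assumes "A $ 1 $ 1 = a" "A $ 1 $ 2 = b" "A $ 1 $ 3 = c" "A $ 2 $ 1 = d" "A $ 2 $ 2 = e"
    "A $ 2 $ 3 = f" "A $ 3 $ 1 = g" "A $ 3 $ 2 = h" "A $ 3 $ 3 = i"
  shows "A = matrix3 a b c d e f g h i"
  using assms by (simp add: vec_eq_iff forall_3)

lemma matrix3_exhaust:
  obtains a b c d e f g h i where "A = matrix3 a b c d e f g h i"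
  using matrix3_eqI by blast

lemma matrix3_eq_iff [simp]:
  "matrix3 a b c d e f g h i = matrix3 a' b' c' d' e' f' g' h' i' \<longleftrightarrow>
   a = a' \<and> b = b' \<and> c = c' \<and> d = d' \<and> e = e' \<and> f = f' \<and> g = g' \<and> h = h' \<and> i = i'"
  by (auto simp: vec_eq_iff forall_3)

lemma matrix3_mult [simp]:
  "matrix3 a b c d e f g h i ** matrix3 a' b' c' d' e' f' g' h' i' =
   matrix3 (a * a' + b * d' + c * g') (a * b' + b * e' + c * h') (a * c' + b * f' + c * i')
           (d * a' + e * d' + f * g') (d * b' + e * e' + f * h') (d * c' + e * f' + f * i')
           (g * a' + h * d' + i * g') (g * b' + h * e' + i * h') (g * c' + h * f' + i * i')"
  by (rule matrix3_eqI) (simp_all add: matrix_matrix_mult_def sum_3)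

lemma mat_matrix3: "mat x = matrix3 x 0 0 0 x 0 0 0 x"
  by (rule matrix3_eqI) (simp_all add: mat_def)

lemma mat_1_matrix3: "mat 1 = matrix3 1 0 0 0 1 0 0 0 1"
  by (rule matrix3_eqI) (simp_all add: mat_def)

lemma det_matrix3 [simp]:
  "det (matrix3 a b c d e f g h i) =
   a * e * i + b * f * g + c * d * h - a * f * h - b * d * i - c * e * g"
  by (simp add: det_3)

lemma transvection_matrix3 [simp]:
  "transvection 1 2 a = matrix3 1 a 0 0 1 0 0 0 1" "transvection 1 3 a = matrix3 1 0 a 0 1 0 0 0 1"
  "transvection 2 1 a = matrix3 1 0 0 a 1 0 0 0 1" "transvection 2 3 a = matrix3 1 0 0 0 1 a 0 0 1"
  "transvection 3 1 a = matrix3 1 0 0 0 1 0 a 0 1" "transvection 3 2 a = matrix3 1 0 0 0 1 0 0 a 1"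
  by (rule matrix3_eqI; simp add: transvection_def matrix_unit_def mat_def)+

lemma charpoly_matrix3:
  "charpoly (matrix3 a b c d e f g h i) =
   [:-det (matrix3 a b c d e f g h i), a * e - b * d + (a * i - c * g) + (e * i - f * h),
     -(a + e + i), 1:]"
  by (simp add: charpoly_def det_3 mat_def algebra_simps)

lemma obtain_matrix_inverse:
  fixes A :: "'a::field^'n^'n"
  assumes "det A \<noteq> 0"
  obtains B where "A ** B = mat 1" "B ** A = mat 1" "det B = inverse (det A)"
proof -
  obtain B where B: "A ** B = mat 1" "B ** A = mat 1"
    using assms by (auto simp: invertible_det_nz[symmetric] invertible_def)
  have "det A * det B = 1" by (metis B(1) det_mul det_I)
  then have "det B = inverse (det A)" by (metis inverse_unique)
  with B show ?thesis using that by blast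
qed

subsection \<open>The special linear group is generated by transvections\<close>

lemma E3_mult: "A \<in> E3 \<Longrightarrow> B \<in> E3 \<Longrightarrow> A ** B \<in> E3"
  using generate.eng[of A GL3 _ B] by (simp add: E3_def GL3_def)

lemma transvection_in_E3: "i \<noteq> j \<Longrightarrow> transvection i j a \<in> E3"
  unfolding E3_def by (rule generate.incl) auto

lemma E3_generators:
  "transvection 1 2 a \<in> E3" "transvection 1 3 a \<in> E3" "transvection 2 1 a \<in> E3"
  "transvection 2 3 a \<in> E3" "transvection 3 1 a \<in> E3" "transvection 3 2 a \<in> E3"
  by (rule transvection_in_E3, simp)+

lemma E3_elementary_cancel:
  assumes "transvection i j a ** A \<in> E3" "i \<noteq> j"
  shows "A \<in> E3"
proof -
  have "transvection i j (-a) ** transvection i j a = (mat 1 :: 'a^3^3)"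
    using exhaust_3[of i] exhaust_3[of j] assms(2) by (auto simp: mat_1_matrix3)
  then have "A = transvection i j (-a) ** (transvection i j a ** A)"
    by (metis matrix_mul_assoc matrix_mul_lid)
  then show ?thesis by (metis E3_mult assms transvection_in_E3)
qed

text \<open>If c is nonzero, the block factors as upper times lower times upper unitriangular. If c
  = 0 then a is nonzero, and adding the second row to the third puts a in the place of c.\<close>

lemma block_in_E3:
  assumes "a * d - b * c = (1 :: 'a::field)"
  shows "matrix3 1 0 0 0 a b 0 c d \<in> E3"
proof -
  have *: "matrix3 1 0 0 0 a b 0 c d \<in> E3" if "c \<noteq> 0" "a * d - b * c = 1" for a b c d :: 'a
  proof -
    have "matrix3 1 0 0 0 a b 0 c d =
        transvection 2 3 ((a - 1) / c) ** transvection 3 2 c ** transvection 2 3 ((d - 1) / c)"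
      using that by (simp add: field_simps)
    then show ?thesis by (metis E3_mult E3_generators(4,6))
  qed
  show ?thesis
  proof (cases "c = 0")
    case True
    then have "a \<noteq> 0" "a * (b + d) - b * a = 1" using assms by (auto simp: algebra_simps)
    then have "matrix3 1 0 0 0 a b 0 a (b + d) \<in> E3" by (rule *)
    then have "transvection 3 2 1 ** matrix3 1 0 0 0 a b 0 c d \<in> E3"
      using True by simp
    then show ?thesis by (rule E3_elementary_cancel) simp
  qed (use * assms in blast)
qed

lemma det_1_in_E3:
  fixes A :: "'a::field^3^3"
  assumes "det A = 1"
  shows "A \<in> E3"
proof -
  \<comment> \<open>Gaussian elimination: a corner entry 1 clears its row and column, which leaves a
    2 by 2 block of determinant 1.\<close>
  have one: "A \<in> E3" if "A = matrix3 1 b c d e f g h i" "det A = 1"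
    for A :: "'a^3^3" and b c d e f g h i
  proof -
    have "matrix3 1 0 0 0 (e - d * b) (f - d * c) 0 (h - g * b) (i - g * c) \<in> E3"
      using that by (intro block_in_E3) (simp add: algebra_simps)
    moreover have "A = transvection 2 1 d ** (transvection 3 1 g **
        (matrix3 1 0 0 0 (e - d * b) (f - d * c) 0 (h - g * b) (i - g * c) **
         (transvection 1 2 b ** transvection 1 3 c)))"
      using that by simp
    ultimately show ?thesis by (metis E3_generators E3_mult transvection_matrix3)
  qed
  \<comment> \<open>A nonzero entry directly below the corner allows a row operation that turns the
    corner into 1.\<close>
  have two: "A \<in> E3" if "A = matrix3 a b c d e f g h i" "det A = 1" "d \<noteq> 0"
    for A :: "'a^3^3" and a b c d e f g h i
  proof -
    have "det (transvection 1 2 ((1 - a) / d) ** A) = 1"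
      by (subst det_mul) (simp add: that(2))
    then have "transvection 1 2 ((1 - a) / d) ** A \<in> E3"
      by (intro one) (use that in simp_all)
    then show ?thesis by (rule E3_elementary_cancel) simp
  qed
  obtain a b c d e f g h i where A: "A = matrix3 a b c d e f g h i" by (rule matrix3_exhaust)
  \<comment> \<open>The first column is nonzero, so at most one row addition makes the entry at
    position (2,1) nonzero.\<close>
  consider "d \<noteq> 0" | "d = 0" "g \<noteq> 0" | "d = 0" "a \<noteq> 0"
    using assms by (fastforce simp: A)
  then show ?thesis
  proof cases
    case 2
    have "det (transvection 2 3 1 ** A) = 1"
      by (subst det_mul) (simp add: assms)
    then have "transvection 2 3 1 ** A \<in> E3"
      by (intro two[OF _ _ 2(2)]) (use A 2 in simp_all)
    then show ?thesis by (rule E3_elementary_cancel) simp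
  next
    case 3
    have "det (transvection 2 1 1 ** A) = 1"
      by (subst det_mul) (simp add: assms)
    then have "transvection 2 1 1 ** A \<in> E3"
      by (intro two[OF _ _ 3(2)]) (use A 3 in simp_all)
    then show ?thesis by (rule E3_elementary_cancel) simp
  qed (use two A assms in blast)
qed

subsection \<open>Conjugacy\<close>

text \<open>The intertwining form avoids inverses, so an explicit \<open>p\<close> is verified by
  multiplying matrices.\<close>

definition gl_conj :: "'a::field^3^3 \<Rightarrow> 'a^3^3 \<Rightarrow> bool" where
  "gl_conj A B \<longleftrightarrow> (\<exists>p. det p \<noteq> 0 \<and> p ** A = B ** p)"

definition sl_conj :: "'a::field^3^3 \<Rightarrow> 'a^3^3 \<Rightarrow> bool" where
  "sl_conj A B \<longleftrightarrow> (\<exists>p. det p = 1 \<and> p ** A = B ** p)"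

lemma sl_conjI: "det p = 1 \<Longrightarrow> p ** A = B ** p \<Longrightarrow> sl_conj A B"
  by (auto simp: sl_conj_def)

lemma gl_conjI: "det p \<noteq> 0 \<Longrightarrow> p ** A = B ** p \<Longrightarrow> gl_conj A B"
  by (auto simp: gl_conj_def)

lemma gl_conj_trans:
  assumes "gl_conj A B" "gl_conj B C"
  shows "gl_conj A C"
proof -
  obtain p q where "det p \<noteq> 0" "p ** A = B ** p" "det q \<noteq> 0" "q ** B = C ** q"
    using assms by (auto simp: gl_conj_def)
  then have "det (q ** p) \<noteq> 0 \<and> (q ** p) ** A = C ** (q ** p)"
    by (metis det_mul matrix_mul_assoc mult_eq_0_iff)
  then show ?thesis by (auto simp: gl_conj_def)
qed

lemma gl_conj_sym:
  assumes "gl_conj A B"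
  shows "gl_conj B A"
proof -
  obtain p where p: "det p \<noteq> 0" "p ** A = B ** p" using assms by (auto simp: gl_conj_def)
  obtain q where q: "p ** q = mat 1" "q ** p = mat 1" "det q = inverse (det p)"
    using obtain_matrix_inverse[OF p(1)] .
  have "q ** B = A ** q"
    by (metis p(2) q(1,2) matrix_mul_assoc matrix_mul_lid matrix_mul_rid)
  moreover have "det q \<noteq> 0" using p(1) q(3) by simp
  ultimately show ?thesis by (rule gl_conjI[rotated])
qed

lemma sl_conj_sym:
  assumes "sl_conj A B"
  shows "sl_conj B A"
proof -
  obtain p where p: "det p = 1" "p ** A = B ** p" using assms by (auto simp: sl_conj_def)
  obtain q where q: "p ** q = mat 1" "q ** p = mat 1" "det q = inverse (det p)"
    using obtain_matrix_inverse[of p] p by auto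
  have "q ** B = A ** q"
    by (metis p(2) q(1,2) matrix_mul_assoc matrix_mul_lid matrix_mul_rid)
  then show ?thesis using p q by (auto simp: sl_conj_def)
qed

lemma sl_imp_gl_conj: "sl_conj A B \<Longrightarrow> gl_conj A B"
  by (metis sl_conj_def gl_conj_def zero_neq_one)

text \<open>The centralizer of a transvection contains matrices of every nonzero determinant.\<close>

lemma gl_conj_transvection_imp_sl_conj:
  fixes A :: "'a::field^3^3"
  assumes "gl_conj A (transvection 1 2 1)"
  shows "sl_conj A (transvection 1 2 1)"
proof -
  obtain p where p: "det p \<noteq> 0" "p ** A = transvection 1 2 1 ** p"
    using assms by (auto simp: gl_conj_def)
  define s :: "'a^3^3" where "s = matrix3 1 0 0 0 1 0 0 0 (inverse (det p))"
  have "s ** transvection 1 2 1 = transvection 1 2 1 ** s" by (simp add: s_def)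
  then have "(s ** p) ** A = transvection 1 2 1 ** (s ** p)"
    using p(2) by (metis matrix_mul_assoc)
  moreover have "det (s ** p) = 1" using p(1) by (simp add: s_def det_mul)
  ultimately show ?thesis by (rule sl_conjI[rotated])
qed

text \<open>The matrix is the identity plus the column (u,v,w) times the row (x,y,z), a rank-one
  matrix of square zero. In a basis consisting of the column, a vector on which the row takes the
  value 1, and a further vector killed by the row, it becomes
  \<open>transvection 1 2 1\<close>.\<close>

lemma rank_one_gl_conj_transvection:
  fixes u v w x y z :: "'a::field"
  assumes "u * x + v * y + w * z = 0" "\<not> (u = 0 \<and> v = 0 \<and> w = 0)" "\<not> (x = 0 \<and> y = 0 \<and> z = 0)"
  shows "gl_conj (matrix3 (1 + u * x) (u * y) (u * z) (v * x) (1 + v * y) (v * z)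
    (w * x) (w * y) (1 + w * z)) (transvection 1 2 1)"
proof -
  have ex: "\<exists>r s t. a * r + b * s + c * t = 1" if "\<not> (a = 0 \<and> b = 0 \<and> c = 0)" for a b c :: 'a
    using that by (metis add.left_neutral add.right_neutral mult_zero_right right_inverse)
  obtain k l m where k: "u * k + v * l + w * m = 1" using ex assms(2) by blast
  obtain r s t where r: "x * r + y * s + z * t = 1" using ex assms(3) by blast
  \<comment> \<open>The third column is the cross product of (x,y,z) and (k,l,m), hence is killed by
    the row (x,y,z).\<close>
  define p where "p = matrix3 u r (y * m - z * l) v s (z * k - x * m) w t (x * l - y * k)"
  \<comment> \<open>Binet-Cauchy identity for the triple product; its value here is 0 - 1.\<close>
  have "det p = (u * x + v * y + w * z) * (r * k + s * l + t * m)
      - (u * k + v * l + w * m) * (x * r + y * s + z * t)"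
    by (simp add: p_def algebra_simps)
  then have "det p \<noteq> 0" using assms(1) k r by simp
  have c: "x * u + y * v + z * w = 0"
      "x * (y * m - z * l) + y * (z * k - x * m) + z * (x * l - y * k) = 0"
    using assms(1) by (simp_all add: algebra_simps)
  have rows: "(1 + u * x) * a + u * y * b + u * z * c = a + u * (x * a + y * b + z * c)"
      "v * x * a + (1 + v * y) * b + v * z * c = b + v * (x * a + y * b + z * c)"
      "w * x * a + w * y * b + (1 + w * z) * c = c + w * (x * a + y * b + z * c)" for a b c
    by (simp_all add: algebra_simps)
  have "p ** transvection 1 2 1 = matrix3 (1 + u * x) (u * y) (u * z) (v * x) (1 + v * y)
      (v * z) (w * x) (w * y) (1 + w * z) ** p" 
    unfolding p_def transvection_matrix3 matrix3_mult matrix3_eq_iff rows c r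
    by (simp add: add.commute)
  with \<open>det p \<noteq> 0\<close> show ?thesis by (intro gl_conj_sym[OF gl_conjI])
qed

subsection \<open>Conjugacy classes in the general linear group\<close>

interpretation GL3: group "GL3 :: ('k::field^3^3) monoid"
  by (rule group_GL3)

lemma GL3_simps [simp]: "mult GL3 = (**)" "one GL3 = mat 1"
  by (simp_all add: GL3_def)

lemma carrier_GL3_iff: "A \<in> carrier GL3 \<longleftrightarrow> det A \<noteq> 0"
  by (simp add: GL3_def invertible_det_nz)

lemma inv_GL3_mult:
  assumes "A \<in> carrier GL3"
  shows "inv\<^bsub>GL3\<^esub> A ** A = mat 1" "A ** inv\<^bsub>GL3\<^esub> A = mat 1"
  using GL3.l_inv[OF assms] GL3.r_inv[OF assms] by simp_all

lemma det_inv_GL3: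
  assumes "A \<in> carrier GL3"
  shows "det (inv\<^bsub>GL3\<^esub> A) = inverse (det A)"
proof -
  have "det A * det (inv\<^bsub>GL3\<^esub> A) = 1"
    using inv_GL3_mult(2)[OF assms] by (metis det_mul det_I)
  then show ?thesis by (metis inverse_unique)
qed

lemma mem_conj_class_iff:
  assumes "subgroup H GL3"
  shows "y \<in> conj_class H g \<longleftrightarrow> (\<exists>h\<in>H. h ** y = g ** h)"
proof -
  have "y = inv\<^bsub>GL3\<^esub> h ** g ** h \<longleftrightarrow> h ** y = g ** h" if "h \<in> H" for h
  proof
    assume "y = inv\<^bsub>GL3\<^esub> h ** g ** h"
    then have "h ** y = (h ** inv\<^bsub>GL3\<^esub> h) ** (g ** h)" by (simp only: matrix_mul_assoc)
    then show "h ** y = g ** h"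
      by (simp only: inv_GL3_mult(2)[OF subgroup.mem_carrier[OF assms that]] matrix_mul_lid)
  next
    assume "h ** y = g ** h"
    then have "inv\<^bsub>GL3\<^esub> h ** g ** h = (inv\<^bsub>GL3\<^esub> h ** h) ** y"
      by (simp only: matrix_mul_assoc[symmetric])
    then show "y = inv\<^bsub>GL3\<^esub> h ** g ** h"
      by (simp only: inv_GL3_mult(1)[OF subgroup.mem_carrier[OF assms that]] matrix_mul_lid)
  qed
  then show ?thesis by (auto simp: conj_class_def)
qed

lemma conj_class_closed:
  assumes "subgroup H GL3" "g \<in> carrier GL3"
  shows "conj_class H g \<subseteq> carrier GL3"
proof
  fix y assume "y \<in> conj_class H g"
  then obtain h where h: "h \<in> H" "y = inv\<^bsub>GL3\<^esub> h \<otimes>\<^bsub>GL3\<^esub> g \<otimes>\<^bsub>GL3\<^esub> h"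
    by (auto simp: conj_class_def)
  show "y \<in> carrier GL3"
    unfolding h(2) using subgroup.mem_carrier[OF assms(1) h(1)] assms(2)
    by (intro GL3.m_closed GL3.inv_closed)
qed

lemma conj_class_self: "subgroup H GL3 \<Longrightarrow> g \<in> conj_class H g"
  using subgroup.one_closed[of H GL3]
  by (subst mem_conj_class_iff) (simp_all add: bexI[of _ "mat 1"])

lemma conj_class_sym:
  assumes "subgroup H GL3" "y \<in> conj_class H g"
  shows "g \<in> conj_class H y"
proof -
  obtain h where h: "h \<in> H" "h ** y = g ** h" using assms by (auto simp: mem_conj_class_iff)
  have "inv\<^bsub>GL3\<^esub> h ** g = y ** inv\<^bsub>GL3\<^esub> h"
    using inv_GL3_mult[OF subgroup.mem_carrier[OF assms(1) h(1)]] h(2)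
    by (metis matrix_mul_assoc matrix_mul_lid matrix_mul_rid)
  then show ?thesis
    using subgroup.m_inv_closed[OF assms(1) h(1)] assms(1) by (auto simp: mem_conj_class_iff)
qed

lemma conj_class_trans:
  assumes "subgroup H GL3" "y \<in> conj_class H g" "z \<in> conj_class H y"
  shows "z \<in> conj_class H g"
proof -
  obtain h k where h: "h \<in> H" "h ** y = g ** h" "k \<in> H" "k ** z = y ** k"
    using assms by (auto simp: mem_conj_class_iff)
  have "(h ** k) ** z = g ** (h ** k)" by (metis h(2,4) matrix_mul_assoc)
  moreover have "h ** k \<in> H" using subgroup.m_closed[OF assms(1) h(1,3)] by simp
  ultimately show ?thesis using assms(1) by (auto simp: mem_conj_class_iff)
qed

lemma conj_class_eq: "subgroup H GL3 \<Longrightarrow> y \<in> conj_class H g \<Longrightarrow> conj_class H y = conj_class H g"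
  using conj_class_trans[of H y g] conj_class_trans[of H g y] conj_class_sym[of H y g] by blast

lemma det_mem_conj_class:
  "subgroup H GL3 \<Longrightarrow> g \<in> carrier GL3 \<Longrightarrow> y \<in> conj_class H g \<Longrightarrow> det y = det g"
  by (rule det_conj_class[symmetric]) (assumption | rule conj_class_eq[symmetric])+

lemma charpoly_mem_conj_class:
  "subgroup H GL3 \<Longrightarrow> g \<in> carrier GL3 \<Longrightarrow> y \<in> conj_class H g \<Longrightarrow> charpoly y = charpoly g"
  by (rule charpoly_conj_class[symmetric]) (assumption | rule conj_class_eq[symmetric])+

lemma inv_mem_conj_class:
  assumes "subgroup H GL3" "g \<in> carrier GL3" "y \<in> conj_class H g"
  shows "inv\<^bsub>GL3\<^esub> y \<in> conj_class H (inv\<^bsub>GL3\<^esub> g)"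
proof -
  have "y \<in> carrier GL3" using conj_class_closed assms by blast
  then have "conj_class H (inv\<^bsub>GL3\<^esub> y) \<subseteq> conj_class H (inv\<^bsub>GL3\<^esub> g)"
    using assms conj_class_eq by (intro conj_class_inv_subset) blast+
  then show ?thesis using conj_class_self[OF assms(1)] by blast
qed

lemma mem_conj_class_inv_iff:
  assumes "subgroup H GL3" "g \<in> carrier GL3" "y \<in> carrier GL3"
  shows "y \<in> conj_class H (inv\<^bsub>GL3\<^esub> g) \<longleftrightarrow> inv\<^bsub>GL3\<^esub> y \<in> conj_class H g"
proof
  assume "y \<in> conj_class H (inv\<^bsub>GL3\<^esub> g)"
  then have "inv\<^bsub>GL3\<^esub> y \<in> conj_class H (inv\<^bsub>GL3\<^esub> (inv\<^bsub>GL3\<^esub> g))"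
    using assms by (intro inv_mem_conj_class) simp_all
  then show "inv\<^bsub>GL3\<^esub> y \<in> conj_class H g" using assms(2) by simp
next
  assume "inv\<^bsub>GL3\<^esub> y \<in> conj_class H g"
  then have "inv\<^bsub>GL3\<^esub> (inv\<^bsub>GL3\<^esub> y) \<in> conj_class H (inv\<^bsub>GL3\<^esub> g)"
    using assms by (intro inv_mem_conj_class)
  then show "y \<in> conj_class H (inv\<^bsub>GL3\<^esub> g)" using assms(3) by simp
qed

text \<open>This is where \<open>E3\<close> being contained in \<open>H\<close> enters: a
  conjugating matrix of determinant 1 lies in \<open>E3\<close>, so conjugacy by such matrices
  yields membership in \<open>H\<close>-classes for every admissible \<open>H\<close>.\<close>

lemma sl_conj_mem_conj_class:
  assumes "subgroup H GL3" "E3 \<subseteq> H" "sl_conj g y"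
  shows "y \<in> conj_class H g"
proof -
  obtain q where "det q = 1" "q ** y = g ** q"
    using sl_conj_sym[OF assms(3)] by (auto simp: sl_conj_def)
  then show ?thesis using assms(1,2) det_1_in_E3 by (auto simp: mem_conj_class_iff)
qed

lemma subgroup_carrier_GL3: "subgroup (carrier GL3) GL3"
  by (rule GL3.subgroup_self)

lemma gl_conj_charpoly:
  assumes "gl_conj A B" "det A \<noteq> 0"
  shows "charpoly A = charpoly B" "det A = det B"
proof -
  obtain p where p: "det p \<noteq> 0" "p ** B = A ** p"
    using gl_conj_sym[OF assms(1)] by (auto simp: gl_conj_def)
  then have "B \<in> conj_class (carrier GL3) A"
    by (auto simp: mem_conj_class_iff subgroup_carrier_GL3 carrier_GL3_iff)
  then show "charpoly A = charpoly B" "det A = det B"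
    using charpoly_mem_conj_class[OF subgroup_carrier_GL3, of A B]
      det_mem_conj_class[OF subgroup_carrier_GL3, of A B] assms(2) by (simp_all add: carrier_GL3_iff)
qed

section \<open>Conjugation-closed sets and signed products of classes\<close>

definition conj_closed :: "('k::field^3^3) set \<Rightarrow> ('k^3^3) set \<Rightarrow> bool" where
  "conj_closed H S \<longleftrightarrow> S \<subseteq> carrier GL3 \<and> (\<forall>s\<in>S. conj_class H s \<subseteq> S)"

lemma conj_closed_conj_class:
  "subgroup H GL3 \<Longrightarrow> g \<in> carrier GL3 \<Longrightarrow> conj_closed H (conj_class H g)"
  using conj_class_closed[of H g] conj_class_trans[of H _ g] unfolding conj_closed_def by blast

text \<open>Conjugating a product by h conjugates both factors by the same h.\<close>

lemma conj_closed_set_mult: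
  assumes "subgroup H GL3" "conj_closed H R" "conj_closed H S"
  shows "conj_closed H (R <#>\<^bsub>GL3\<^esub> S)"
  unfolding conj_closed_def
proof (intro conjI ballI subsetI)
  fix x assume "x \<in> R <#>\<^bsub>GL3\<^esub> S"
  then show "x \<in> carrier GL3"
    using assms(2,3) GL3.set_mult_closed unfolding conj_closed_def by blast
next
  fix x y assume "x \<in> R <#>\<^bsub>GL3\<^esub> S" and y: "y \<in> conj_class H x"
  then obtain r s where x: "r \<in> R" "s \<in> S" "x = r ** s" by (auto simp: set_mult_def)
  obtain h where h: "h \<in> H" "y = inv\<^bsub>GL3\<^esub> h ** x ** h" using y by (auto simp: conj_class_def)
  have "(inv\<^bsub>GL3\<^esub> h ** r ** h) ** (inv\<^bsub>GL3\<^esub> h ** s ** h) =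
      inv\<^bsub>GL3\<^esub> h ** r ** (h ** inv\<^bsub>GL3\<^esub> h) ** s ** h"
    by (simp only: matrix_mul_assoc)
  also have "\<dots> = y"
    using inv_GL3_mult(2)[OF subgroup.mem_carrier[OF assms(1) h(1)]]
    by (simp add: h(2) x(3) matrix_mul_assoc)
  finally have "y = (inv\<^bsub>GL3\<^esub> h ** r ** h) ** (inv\<^bsub>GL3\<^esub> h ** s ** h)" ..
  moreover have "inv\<^bsub>GL3\<^esub> h ** r ** h \<in> R" "inv\<^bsub>GL3\<^esub> h ** s ** h \<in> S"
    using h(1) x(1,2) assms(2,3) unfolding conj_closed_def conj_class_def GL3_simps by blast+
  ultimately show "y \<in> R <#>\<^bsub>GL3\<^esub> S" by (auto simp: set_mult_def)
qed

lemma signed_class_prod_simps [simp]: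
  "signed_class_prod H g [] = {mat 1}"
  "signed_class_prod H g (i # is) = signed_class H g i <#>\<^bsub>GL3\<^esub> signed_class_prod H g is"
  by (simp_all add: signed_class_prod_def)

lemma set_mult_one [simp]: "S <#>\<^bsub>GL3\<^esub> {mat 1} = S"
  by (auto simp: set_mult_def)

lemma signed_class_pm [simp]:
  "signed_class H g 1 = conj_class H g" "signed_class H g (-1) = conj_class H (inv\<^bsub>GL3\<^esub> g)"
  by (simp_all add: signed_class_def)

lemma conj_class_subset_iff:
  assumes "subgroup H GL3" "conj_closed H S"
  shows "conj_class H t \<subseteq> S \<longleftrightarrow> t \<in> S"
  using conj_class_self[OF assms(1), of t] assms(2) by (auto simp: conj_closed_def)

lemma conj_closed_signed_class_prod:
  assumes "subgroup H GL3" "g \<in> carrier GL3"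
  shows "conj_closed H (signed_class_prod H g is)"
proof (induction "is")
  case Nil
  have "y = mat 1" if "y \<in> conj_class H (mat 1)" for y
    using that by (auto simp: conj_class_def inv_GL3_mult subgroup.mem_carrier[OF assms(1)])
  then show ?case using GL3.one_closed by (auto simp: conj_closed_def)
next
  case (Cons i "is")
  have "conj_closed H (signed_class H g i)"
    using conj_closed_conj_class[OF assms(1)] assms(2) by (simp add: signed_class_def)
  then show ?case using conj_closed_set_mult[OF assms(1)] Cons.IH by simp
qed

text \<open>Source of the lower bounds by determinants. The list may be arbitrary because
  \<open>signed_class\<close> treats every integer other than 1 like -1.\<close>

lemma det_signed_class_prod:
  assumes "subgroup H GL3" "g \<in> carrier GL3" "x \<in> signed_class_prod H g is"
  shows "det x = (\<Prod>i\<leftarrow>is. if i = 1 then det g else inverse (det g))"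
  using assms(3)
proof (induction "is" arbitrary: x)
  case (Cons i "is")
  then obtain r s where x: "r \<in> signed_class H g i" "s \<in> signed_class_prod H g is" "x = r ** s"
    by (auto simp: set_mult_def)
  have "det r = (if i = 1 then det g else inverse (det g))"
    using x(1) det_mem_conj_class[OF assms(1,2)] det_inv_GL3[OF assms(2)]
      det_mem_conj_class[OF assms(1) GL3.inv_closed[OF assms(2)]]
    by (auto simp: signed_class_def split: if_splits)
  then show ?case using Cons.IH[OF x(2)] by (simp add: x(3) det_mul)
qed simp

text \<open>Signed products are conjugation closed, so containing the whole class of the
  transvection amounts to containing the transvection itself. This serves both for attaining m and
  for excluding shorter lists.\<close>

lemma class_m_eqI:
  assumes "subgroup H GL3" "g \<in> carrier GL3" "m > 0"
    and "length is = m" "set is \<subseteq> {1, -1}" "transvection 1 2 1 \<in> signed_class_prod H g is"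
    and "\<And>is. length is < m \<Longrightarrow> is \<noteq> [] \<Longrightarrow> set is \<subseteq> {1, -1} \<Longrightarrow>
      transvection 1 2 1 \<notin> signed_class_prod H g is"
  shows "class_m H g = m"
  unfolding class_m_def
    conj_class_subset_iff[OF assms(1) conj_closed_signed_class_prod[OF assms(1,2)]]
proof (rule Least_equality)
  fix n assume "n > 0 \<and> (\<exists>is. length is = n \<and> set is \<subseteq> {1, -1} \<and>
    transvection 1 2 1 \<in> signed_class_prod H g is)"
  then show "m \<le> n" using assms(7) by (metis length_0_conv linorder_not_le not_gr_zero)
next
  show "m > 0 \<and> (\<exists>is. length is = m \<and> set is \<subseteq> {1, -1} \<and>
      transvection 1 2 1 \<in> signed_class_prod H g is)"
    by (intro conjI exI[of _ "is"] assms(3-6))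
qed

subsection \<open>Conjugation by an invertible matrix\<close>

definition conj_by :: "'a::field^3^3 \<Rightarrow> 'a^3^3 \<Rightarrow> 'a^3^3" where
  "conj_by q X = q ** X ** inv\<^bsub>GL3\<^esub> q"

lemma conj_by_comm: "det q \<noteq> 0 \<Longrightarrow> q ** X = conj_by q X ** q"
  by (simp add: conj_by_def matrix_mul_assoc[symmetric] inv_GL3_mult carrier_GL3_iff)

lemma gl_conj_conj_by: "det q \<noteq> 0 \<Longrightarrow> gl_conj X (conj_by q X)"
  by (rule gl_conjI[OF _ conj_by_comm])

lemma gl_conjE:
  assumes "gl_conj A B"
  obtains q where "det q \<noteq> 0" "B = conj_by q A"
proof -
  obtain q where q: "det q \<noteq> 0" "q ** A = B ** q" using assms by (auto simp: gl_conj_def)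
  have "conj_by q A = B ** (q ** inv\<^bsub>GL3\<^esub> q)" by (simp add: conj_by_def q(2) matrix_mul_assoc)
  then show ?thesis using that q(1) by (simp add: inv_GL3_mult carrier_GL3_iff)
qed

lemma conj_by_mult:
  assumes "det q \<noteq> 0"
  shows "conj_by q (X ** Y) = conj_by q X ** conj_by q Y"
proof -
  have "conj_by q X ** conj_by q Y = q ** X ** (inv\<^bsub>GL3\<^esub> q ** q) ** Y ** inv\<^bsub>GL3\<^esub> q"
    by (simp only: conj_by_def matrix_mul_assoc)
  also have "inv\<^bsub>GL3\<^esub> q ** q = mat 1" using assms by (simp add: inv_GL3_mult carrier_GL3_iff)
  finally show ?thesis by (simp add: conj_by_def matrix_mul_assoc)
qed

lemma det_conj_by: "det q \<noteq> 0 \<Longrightarrow> det (conj_by q X) = det X"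
  by (simp add: conj_by_def det_mul det_inv_GL3 carrier_GL3_iff)

text \<open>Normal forms are reached by matrices of arbitrary nonzero determinant, yet conjugacy
  with determinant 1 survives the transport: the intertwiner is conjugated along and keeps its
  determinant.\<close>

lemma sl_conj_conj_by:
  assumes "det q \<noteq> 0" "sl_conj X Y"
  shows "sl_conj (conj_by q X) (conj_by q Y)"
proof -
  obtain p where "det p = 1" "p ** X = Y ** p" using assms(2) by (auto simp: sl_conj_def)
  then show ?thesis
    by (intro sl_conjI[of "conj_by q p"])
      (simp_all add: det_conj_by conj_by_mult[symmetric] assms(1))
qed

lemma conj_by_mat: "det q \<noteq> 0 \<Longrightarrow> conj_by q (mat a) = mat a"
proof -
  assume q: "det q \<noteq> 0"
  have "q ** mat a = mat a ** q"
    by (rule matrix3_exhaust[of q]) (simp add: mat_matrix3 mult.commute)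
  then have "conj_by q (mat a) = mat a ** (q ** inv\<^bsub>GL3\<^esub> q)"
    by (simp add: conj_by_def matrix_mul_assoc)
  then show ?thesis using q by (simp add: inv_GL3_mult carrier_GL3_iff)
qed

lemma conj_by_cancel:
  assumes "det q \<noteq> 0" "conj_by q X = conj_by q Y"
  shows "X = Y"
proof -
  have "inv\<^bsub>GL3\<^esub> q ** (q ** X) = inv\<^bsub>GL3\<^esub> q ** (q ** Y)"
    using conj_by_comm[OF assms(1)] assms(2) by simp
  then show ?thesis
    unfolding matrix_mul_assoc using assms(1) by (simp add: inv_GL3_mult carrier_GL3_iff)
qed

lemma sl_conj_transvection_conj_by:
  assumes "det q \<noteq> 0" "sl_conj t (transvection 1 2 1)"
  shows "sl_conj (conj_by q t) (transvection 1 2 1)"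
  using gl_conj_trans[OF gl_conj_sym[OF gl_conj_conj_by[OF assms(1)]] sl_imp_gl_conj[OF assms(2)]]
  by (rule gl_conj_transvection_imp_sl_conj)

subsection \<open>Matrices with an eigenvalue in the field\<close>

lemma charpoly_root_block_form:
  fixes g :: "'a::field^3^3"
  assumes "poly (charpoly g) x = 0"
  obtains a b c d e f where "gl_conj (matrix3 x a b 0 c d 0 e f) g"
proof -
  obtain a b c d e f k l m where g: "g = matrix3 a b c d e f k l m" by (rule matrix3_exhaust)
  let ?A = "matrix3 (a - x) b c d (e - x) f k l (m - x)"
  have "det ?A = - poly (charpoly g) x"
    by (simp add: g charpoly_matrix3 algebra_simps)
  then have "\<not> invertible ?A" using assms by (simp add: invertible_det_nz)
  then obtain v where v: "v \<noteq> 0" "?A *v v = 0"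
    using matrix_left_invertible_ker[of ?A] matrix_left_right_inverse[of _ ?A]
    unfolding invertible_def by blast
  define p q r where "p = v $ 1" and "q = v $ 2" and "r = v $ 3"
  have "p \<noteq> 0 \<or> q \<noteq> 0 \<or> r \<noteq> 0"
    using v(1) by (simp add: vec_eq_iff forall_3 p_def q_def r_def)
  moreover have eqs: "a * p + b * q + c * r = x * p" "d * p + e * q + f * r = x * q"
      "k * p + l * q + m * r = x * r"
    using v(2) by (simp_all add: vec_eq_iff forall_3 matrix_vector_mult_def sum_3 p_def q_def r_def
      algebra_simps)
  \<comment> \<open>The eigenvector (p,q,r) becomes the first column of a base change; two standard
    basis vectors complete it.\<close>
  ultimately have "\<exists>Q :: 'a^3^3. det Q \<noteq> 0 \<and> Q $ 1 $ 1 = p \<and> Q $ 2 $ 1 = q \<and> Q $ 3 $ 1 = r"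
  proof (elim disjE)
    assume "p \<noteq> 0" then show ?thesis by (intro exI[of _ "matrix3 p 0 0 q 1 0 r 0 1"]) simp
  next
    assume "q \<noteq> 0" then show ?thesis by (intro exI[of _ "matrix3 p 1 0 q 0 0 r 0 1"]) simp
  next
    assume "r \<noteq> 0" then show ?thesis by (intro exI[of _ "matrix3 p 1 0 q 0 1 r 0 0"]) simp
  qed
  then obtain Q :: "'a^3^3" where Q: "det Q \<noteq> 0" "Q $ 1 $ 1 = p" "Q $ 2 $ 1 = q" "Q $ 3 $ 1 = r" by blast
  obtain R where R: "Q ** R = mat 1" "R ** Q = mat 1" using obtain_matrix_inverse[OF Q(1)] .
  let ?u = "R ** g ** Q"
  have gQ: "(g ** Q) $ i $ 1 = x * Q $ i $ 1" for i
    using exhaust_3[of i] eqs Q by (auto simp: g matrix_matrix_mult_def sum_3)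
  have "?u $ i $ 1 = x * (R ** Q) $ i $ 1" for i
  proof -
    have entry: "(R ** Z) $ i $ 1 = R $ i $ 1 * Z $ 1 $ 1 + R $ i $ 2 * Z $ 2 $ 1 + R $ i $ 3 * Z $ 3 $ 1"
      for Z :: "'a^3^3"
      by (simp add: matrix_matrix_mult_def sum_3)
    show ?thesis
      unfolding matrix_mul_assoc[symmetric] entry gQ by (simp add: algebra_simps)
  qed
  then have "?u = matrix3 x (?u $ 1 $ 2) (?u $ 1 $ 3) 0 (?u $ 2 $ 2) (?u $ 2 $ 3)
      0 (?u $ 3 $ 2) (?u $ 3 $ 3)"
    by (intro matrix3_eqI) (simp_all add: R mat_def)
  moreover have "gl_conj ?u g"
    by (rule gl_conjI[OF Q(1)]) (metis R(1) matrix_mul_assoc matrix_mul_lid)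
  ultimately show ?thesis using that by metis
qed

text \<open>The equation says that t is the commutator of g and h, so g is t times the conjugate of
  g by h.\<close>

lemma transvection_times_conj:
  fixes g :: "'a::field^3^3"
  assumes "det h = 1" "gl_conj t (transvection 1 2 1)" "t ** (h ** g) = g ** h"
  shows "\<exists>t y. sl_conj t (transvection 1 2 1) \<and> sl_conj g y \<and> g = t ** y"
proof -
  obtain k where k: "h ** k = mat 1" "k ** h = mat 1"
    using obtain_matrix_inverse[of h] assms(1) by auto
  have "sl_conj g (h ** g ** k)"
    by (rule sl_conjI[OF assms(1)]) (metis k(2) matrix_mul_assoc matrix_mul_rid)
  moreover have "g = t ** (h ** g ** k)"
    by (metis assms(3) k(1) matrix_mul_assoc matrix_mul_rid)
  ultimately show ?thesis using gl_conj_transvection_imp_sl_conj[OF assms(2)] by blast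
qed

lemma block_transvection_times_conj:
  fixes x a b c d e f :: "'a::field"
  defines "g \<equiv> matrix3 x a b 0 c d 0 e f"
  assumes "det g \<noteq> 0" "g \<noteq> mat x"
  shows "\<exists>t y. sl_conj t (transvection 1 2 1) \<and> sl_conj g y \<and> g = t ** y"
proof -
  define D where "D = c * f - d * e"
  have D: "D \<noteq> 0" "x \<noteq> 0" using assms(2) by (auto simp: g_def D_def algebra_simps)
  \<comment> \<open>Here h has first row (1,u,v), and its commutator with g has first row (1,k,l).
    With G the lower right block, (k,l) G = x (u,v) - (u,v) G, so (k,l) is nonzero unless (u,v) is a
    left eigenvector of G for x.\<close>
  have row: ?thesis if uv: "\<not> (x * u = u * c + v * e \<and> x * v = u * d + v * f)" for u v
  proof -
    define A B where "A = x * u - u * c - v * e" and "B = x * v - u * d - v * f"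
    \<comment> \<open>Cramer's rule for (k,l) G = (A,B).\<close>
    define k l where "k = (A * f - B * e) / D" and "l = (B * c - A * d) / D"
    have "(A * f - B * e) * c + (B * c - A * d) * e = A * D"
        "(A * f - B * e) * d + (B * c - A * d) * f = B * D"
      by (simp_all add: D_def algebra_simps)
    then have "k * c + l * e = A" "k * d + l * f = B"
      using D by (simp_all add: k_def l_def add_divide_distrib[symmetric])
    then have kl: "k * c + l * e = x * u - u * c - v * e" "k * d + l * f = x * v - u * d - v * f"
      by (simp_all add: A_def B_def)
    have "\<not> (k = 0 \<and> l = 0)" using kl uv by (auto simp: algebra_simps)
    then have "gl_conj (matrix3 1 k l 0 1 0 0 0 1) (transvection 1 2 1)"
      using rank_one_gl_conj_transvection[of 1 0 0 k 0 l] by simp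
    moreover have "matrix3 1 k l 0 1 0 0 0 1 ** (matrix3 1 u v 0 1 0 0 0 1 ** g) =
        g ** matrix3 1 u v 0 1 0 0 0 1"
      using kl by (simp add: g_def algebra_simps)
    ultimately show ?thesis by (rule transvection_times_conj[rotated]) simp
  qed
  show ?thesis
  proof (cases "c = x \<and> d = 0 \<and> e = 0 \<and> f = x")
    case False
    then show ?thesis using row[of 1 0] row[of 0 1] by auto
  next
    \<comment> \<open>Now G is scalar and every (u,v) fails. Instead h is taken inside the block, so
      that the commutator picks up the nonzero entry a or b, divided by x.\<close>
    case True
    then have g: "g = matrix3 x a b 0 x 0 0 0 x" by (simp add: g_def)
    then have "a \<noteq> 0 \<or> b \<noteq> 0" using assms(3) by (auto simp: mat_matrix3)
    then show ?thesis
    proof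
      assume "a \<noteq> 0"
      then have "gl_conj (matrix3 1 0 (a / x) 0 1 0 0 0 1) (transvection 1 2 1)"
        using D rank_one_gl_conj_transvection[of 1 0 0 0 0 "a / x"] by simp
      then show ?thesis
        by (rule transvection_times_conj[of "matrix3 1 0 0 0 1 1 0 0 1", rotated])
          (use D in \<open>simp_all add: g\<close>)
    next
      assume "b \<noteq> 0"
      then have "gl_conj (matrix3 1 (b / x) 0 0 1 0 0 0 1) (transvection 1 2 1)"
        using D rank_one_gl_conj_transvection[of 1 0 0 "b / x" 0 0] by simp
      then show ?thesis
        by (rule transvection_times_conj[of "matrix3 1 0 0 0 1 0 0 1 1", rotated])
          (use D in \<open>simp_all add: g\<close>)
    qed
  qed
qed

lemma root_transvection_times_conj:
  fixes g :: "'a::field^3^3"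
  assumes "det g \<noteq> 0" "poly (charpoly g) x = 0" "g \<noteq> mat x"
  shows "\<exists>t y. sl_conj t (transvection 1 2 1) \<and> sl_conj g y \<and> g = t ** y"
proof -
  obtain a b c d e f where "gl_conj (matrix3 x a b 0 c d 0 e f) g"
    using charpoly_root_block_form[OF assms(2)] .
  then obtain q where q: "det q \<noteq> 0" "g = conj_by q (matrix3 x a b 0 c d 0 e f)"
    by (rule gl_conjE)
  let ?g = "matrix3 x a b 0 c d 0 e f"
  have "?g \<noteq> mat x" using q assms(3) conj_by_mat by metis
  moreover have "det ?g \<noteq> 0" using assms(1) unfolding q(2) det_conj_by[OF q(1)] .
  ultimately obtain t y where
    ty: "sl_conj t (transvection 1 2 1)" "sl_conj ?g y" "?g = t ** y"
    using block_transvection_times_conj[of x a b c d e f] by blast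
  have "g = conj_by q t ** conj_by q y"
    unfolding q(2) ty(3) by (rule conj_by_mult[OF q(1)])
  moreover have "sl_conj g (conj_by q y)"
    unfolding q(2) by (rule sl_conj_conj_by[OF q(1) ty(2)])
  ultimately show ?thesis using sl_conj_transvection_conj_by[OF q(1) ty(1)] by blast
qed

subsection \<open>Matrices without eigenvalue in the field\<close>

text \<open>Signs are chosen so that a, b and d are the trace, the sum of the principal 2 by 2
  minors and the determinant.\<close>

definition companion3 :: "'a::field \<Rightarrow> 'a \<Rightarrow> 'a \<Rightarrow> 'a^3^3" where
  "companion3 a b d = matrix3 0 0 d 1 0 (- b) 0 1 a"

lemma det_companion3 [simp]: "det (companion3 a b d) = d"
  by (simp add: companion3_def)

lemma charpoly_companion3: "poly (charpoly (companion3 a b d)) x = x ^ 3 - a * x ^ 2 + b * x - d"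
  by (simp add: companion3_def charpoly_matrix3 algebra_simps power3_eq_cube power2_eq_square)

lemma gl_conj_companion3:
  fixes g :: "'a::field^3^3"
  assumes "det g \<noteq> 0" "\<nexists>x. poly (charpoly g) x = 0"
  obtains a b where "gl_conj (companion3 a b (det g)) g"
proof -
  obtain a b c p e f q l m where g: "g = matrix3 a b c p e f q l m" by (rule matrix3_exhaust)
  \<comment> \<open>The columns are e1, g e1 and g (g e1), where e1 is the first standard basis
    vector.\<close>
  define Q where "Q = matrix3 1 a (a * a + b * p + c * q) 0 p (p * a + e * p + f * q)
    0 q (q * a + l * p + m * q)"
  have "det Q \<noteq> 0"
  proof
    assume "det Q = 0"
    \<comment> \<open>This says that (p,q) is zero or an eigenvector of the lower right block. Then
      e1 and g e1 span an invariant subspace of dimension at most 2. If p = q = 0, then e1 is an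
      eigenvector; otherwise the root exhibited is the eigenvalue on the one-dimensional
      quotient.\<close>
    then have Q: "l * p * p + (m - e) * p * q - f * q * q = 0"
      by (simp add: Q_def algebra_simps)
    have root: "poly (charpoly g) y = y ^ 3 - (a + e + m) * y ^ 2 +
        (a * e - b * p + (a * m - c * q) + (e * m - f * l)) * y - det g" for y
      by (simp add: g charpoly_matrix3 algebra_simps power3_eq_cube power2_eq_square)
    consider "p = 0" "q = 0" | "p \<noteq> 0" | "q \<noteq> 0" by blast
    then have "\<exists>x. poly (charpoly g) x = 0"
    proof cases
      case 1
      then show ?thesis
        by (intro exI[of _ a]) (subst root, simp add: 1 g algebra_simps power3_eq_cube power2_eq_square)
    next
      case 2
      define r where "r = q / p"
      then have q: "q = r * p" using 2 by simp
      have "p * p * (l + (m - e) * r - f * r * r) = 0" using Q by (simp add: q algebra_simps)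
      then have "l + (m - e) * r - f * r * r = 0" using 2 by simp
      then have l: "l = (e - m) * r + f * r * r" by (simp add: algebra_simps)
      show ?thesis
        by (intro exI[of _ "m - f * r"])
          (subst root, simp add: g q l algebra_simps power3_eq_cube power2_eq_square)
    next
      case 3
      define r where "r = p / q"
      then have p: "p = r * q" using 3 by simp
      have "q * q * (l * r * r + (m - e) * r - f) = 0" using Q by (simp add: p algebra_simps)
      then have "l * r * r + (m - e) * r - f = 0" using 3 by simp
      then have f: "f = l * r * r + (m - e) * r" by (simp add: algebra_simps)
      show ?thesis
        by (intro exI[of _ "e - l * r"])
          (subst root, simp add: g p f algebra_simps power3_eq_cube power2_eq_square)
    qed
    then show False using assms(2) by blast
  qed
  moreover have "Q ** companion3 (a + e + m)
      (a * e - b * p + (a * m - c * q) + (e * m - f * l)) (det g) = g ** Q"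
    by (simp add: Q_def companion3_def g algebra_simps)
  ultimately show ?thesis using that gl_conjI by blast
qed

text \<open>If \<open>t = g ** y\<close> is a transvection adding multiples of the first two rows to the third, then
  \<open>y\<close> and \<open>g\<close> have the cyclic frames \<open>(e\<^sub>3, y e\<^sub>3, y\<^sup>2 e\<^sub>3)\<close> and
  \<open>(e\<^sub>1, e\<^sub>2, e\<^sub>3)\<close>. Mapping the first to the negative of the second conjugates \<open>y\<close> to
  \<open>g\<close> as soon as the characteristic polynomials agree, and has determinant 1.\<close>

lemma companion3_square_transvection:
  fixes a b d :: "'a::field"
  defines "g \<equiv> companion3 a b d"
  assumes d: "d ^ 2 = 1" and root: "\<nexists>x. poly (charpoly g) x = 0"
  shows "\<exists>t y. sl_conj t (transvection 1 2 1) \<and> sl_conj g y \<and> t = g ** y"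
proof -
  \<comment> \<open>For y the inverse of g times the transvection with third row (\<psi>, \<phi>,
    1), equality of traces with g forces \<phi> and equality of the sums of principal 2 by 2 minors
    forces \<psi>. The determinants agree because d squared is 1.\<close>
  define \<phi> where "\<phi> = a - b * d"
  define \<psi> where "\<psi> = d * a + d * b * \<phi> - b"
  have dd: "d * d = 1" using d by (simp add: power2_eq_square)
  \<comment> \<open>The characteristic polynomial of g takes the value -\<phi> at d.\<close>
  have "\<phi> \<noteq> 0"
  proof
    assume "\<phi> = 0"
    then have "poly (charpoly g) d = 0"
      using dd by (simp add: g_def charpoly_companion3 \<phi>_def power3_eq_cube power2_eq_square)
    then show False using root by blast
  qed
  then have "gl_conj (matrix3 1 0 0 0 1 0 \<psi> \<phi> 1) (transvection 1 2 1)"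
    using rank_one_gl_conj_transvection[of 0 \<psi> 0 \<phi> 1 0] by simp
  then have "sl_conj (matrix3 1 0 0 0 1 0 \<psi> \<phi> 1) (transvection 1 2 1)"
    by (rule gl_conj_transvection_imp_sl_conj)
  moreover define y where "y = matrix3 (d * b) 1 0 (\<psi> - d * a) \<phi> 1 d 0 0"
  have ddx: "d * (d * z) = z" for z using dd by (metis mult.assoc mult_1)
  have "sl_conj y g"
    by (rule sl_conjI[of "matrix3 0 0 (-1) \<phi> (-1) 0 (-1) 0 0"])
      (simp_all add: y_def g_def companion3_def \<psi>_def \<phi>_def dd ddx algebra_simps)
  moreover have "matrix3 1 0 0 0 1 0 \<psi> \<phi> 1 = g ** y"
    by (simp add: y_def g_def companion3_def \<psi>_def \<phi>_def dd ddx algebra_simps)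
  ultimately show ?thesis using sl_conj_sym by blast
qed

text \<open>The product \<open>M\<close> of the companion matrix \<open>g\<close> with a suitable conjugate has characteristic
  polynomial \<open>(X - 1) (X + d)\<^sup>2\<close> and is cyclic. The matrix \<open>N\<close> is chosen such that
  \<open>N ** g\<close> is a transvection and \<open>N\<close> is cyclic with the same characteristic polynomial; its
  coefficients \<open>p\<close> and \<open>q\<close> are determined by this. Since \<open>1 + d \<noteq> 0\<close>, the cyclic vector
  of \<open>M\<close>, the last column of \<open>r\<close>, can be chosen such that the base change \<open>r\<close> has determinant 1.\<close>

lemma companion3_cube_transvection:
  fixes a b d :: "'a::field"
  defines "g \<equiv> companion3 a b d"
  assumes d: "d ^ 3 = 1" "d \<noteq> -1" and root: "\<nexists>x. poly (charpoly g) x = 0"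
  shows "\<exists>t y z. sl_conj t (transvection 1 2 1) \<and> sl_conj g y \<and> sl_conj g z \<and> t = g ** y ** z"
proof -
  have ddd: "d * (d * d) = 1" using d by (simp add: power3_eq_cube mult.assoc)
  have dddx: "d * (d * (d * x)) = x" for x using ddd by (metis mult.assoc mult_1)
  define B where "B = a + b + 1"
  define C where "C = a + b + B"
  define M where "M = matrix3 (- d) 0 (- d) B 1 C 0 0 (- d)"
  define y where "y = matrix3 (a + 1) 1 (a + b + a + 1) a 0 (a - d) (- 1) 0 (- 1)"
  have y: "sl_conj g y"
    by (rule sl_conj_sym, rule sl_conjI[of "matrix3 0 1 a 1 0 (a + 1) 0 0 (- 1)"])
      (simp_all add: y_def g_def companion3_def algebra_simps)
  have M: "M = g ** y"
    by (simp add: M_def y_def g_def companion3_def B_def C_def algebra_simps)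
  define q where "q = 1 - 2 * d - b * d * d"
  define p where "p = b * d * d * q + a * d * d - d * d + 2 * d"
  define N where "N = matrix3 (b * d * d) 1 0 (p - a * d * d) q 1 (d * d) 0 0"
  have Ng: "N ** g = matrix3 1 0 0 q 1 (d * p - b * q) 0 0 1"
    by (simp add: N_def g_def companion3_def ddd algebra_simps)
  \<comment> \<open>Otherwise \<open>N ** g\<close> is the identity; as \<open>N\<close> has
    eigenvalue 1, so would \<open>g\<close>. The computation recovers a and b from d and checks the
    root 1.\<close>
  have "q \<noteq> 0 \<or> d * p - b * q \<noteq> 0"
  proof (rule ccontr)
    assume "\<not> (q \<noteq> 0 \<or> d * p - b * q \<noteq> 0)"
    then have q: "q = 0" and "d * p = 0" by auto
    then have p: "p = 0" using ddd by auto
    have "b * d * d = 1 - 2 * d" "a * d * d = d * d - 2 * d"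
      using q p by (simp_all add: q_def p_def algebra_simps)
    moreover have "b = (b * d * d) * d" "a = (a * d * d) * d"
      by (simp_all add: mult.assoc ddd)
    ultimately have "b = (1 - 2 * d) * d" "a = (d * d - 2 * d) * d" by simp_all
    then have "b = d - 2 * (d * d)" "a = 1 - 2 * (d * d)"
      by (simp_all add: algebra_simps ddd)
    then have "poly (charpoly g) 1 = 0" by (simp add: g_def charpoly_companion3)
    then show False using root by blast
  qed
  then have "gl_conj (N ** g) (transvection 1 2 1)"
    using rank_one_gl_conj_transvection[of 0 q 1 0 0 "d * p - b * q"] by (simp add: Ng)
  \<comment> \<open>The determinant of \<open>r\<close> is d times (1 + d)^2 x + (1 + d) C - d B, so
    this x makes it d^3 = 1.\<close>
  define x where "x = (d * d - (1 + d) * C + d * B) / (1 + d) ^ 2"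
  have "1 + d \<noteq> 0" using d(2) by (metis add.commute add_eq_0_iff)
  then have "(1 + d) ^ 2 * x = d * d - (1 + d) * C + d * B" by (simp add: x_def)
  then have x: "d * (d * x) = d * d - (1 + d) * C + d * B - x - 2 * (d * x)"
    by (simp add: power2_eq_square algebra_simps)
  define r where "r = matrix3 (2 * d * d + q * d) (- d) 0
    (C + x - d * B - d * C - q * (C + x)) (C + x) x (d * d + q * d) (- d) 1"
  have "det r = 1"
    using ddd x unfolding r_def det_matrix3 by algebra
  have "r ** N = M ** r"
    by (simp add: r_def N_def M_def p_def q_def algebra_simps ddd dddx)
  obtain s where s: "r ** s = mat 1" "s ** r = mat 1"
    using obtain_matrix_inverse[of r] \<open>det r = 1\<close> by auto
  \<comment> \<open>Conjugation by \<open>r\<close> takes \<open>N\<close> to \<open>M\<close> and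
    \<open>g\<close> to \<open>z\<close>, hence the transvection \<open>N ** g\<close> to
    \<open>M ** z\<close>.\<close>
  define z where "z = r ** g ** s"
  have z: "sl_conj g z"
    by (rule sl_conjI[OF \<open>det r = 1\<close>])
      (simp only: z_def matrix_mul_assoc[symmetric] s(2) matrix_mul_rid)
  have "(M ** z) ** r = r ** (N ** g)"
  proof -
    have "(M ** z) ** r = (M ** r) ** g ** (s ** r)" by (simp only: z_def matrix_mul_assoc)
    then show ?thesis
      unfolding \<open>r ** N = M ** r\<close>[symmetric] s(2) by (simp add: matrix_mul_assoc)
  qed
  then have "gl_conj (N ** g) (M ** z)"
    using \<open>det r = 1\<close> by (intro gl_conjI[of r]) simp_all
  then have "sl_conj (M ** z) (transvection 1 2 1)"
    using gl_conj_trans[OF gl_conj_sym] \<open>gl_conj (N ** g) (transvection 1 2 1)\<close>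
      gl_conj_transvection_imp_sl_conj by blast
  then show ?thesis using y z M by blast
qed

text \<open>\<open>M\<close> is the commutator of \<open>g\<close> with
  \<open>transvection 1 3 (- 1)\<close>, and its characteristic polynomial is (X - 1)^3. It supplies
  the nonscalar element with eigenvalue 1 in the class times its inverse.\<close>

lemma companion3_unipotent:
  fixes a b d :: "'a::field"
  defines "g \<equiv> companion3 a b d"
  assumes d: "d \<noteq> 0"
  shows "\<exists>M y. sl_conj g y \<and> g = M ** y \<and> M \<noteq> mat 1 \<and> poly (charpoly M) 1 = 0"
proof -
  define M where "M = matrix3 1 0 1 (- 1 / d) 1 (- 1 / d) 0 0 1"
  define y where "y = matrix3 0 (- 1) (d - a) 1 0 (1 - b) 0 1 a"
  have "sl_conj g y"
    by (rule sl_conjI[of "transvection 1 3 (- 1)"]) (simp_all add: g_def y_def companion3_def)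
  moreover have "g = M ** y"
    using d by (simp add: g_def M_def y_def companion3_def field_simps)
  moreover have "M \<noteq> mat 1" "poly (charpoly M) 1 = 0"
    by (simp_all add: M_def mat_matrix3 charpoly_matrix3)
  ultimately show ?thesis by blast
qed

lemma transvection_mult_charpoly:
  fixes g :: "'a::field^3^3"
  assumes "charpoly (transvection 1 2 1 ** g) = charpoly g \<or> charpoly (g ** transvection 1 2 1) = charpoly g"
  shows "\<exists>x. poly (charpoly g) x = 0"
proof -
  obtain a b c p e f q l m where g: "g = matrix3 a b c p e f q l m" by (rule matrix3_exhaust)
  \<comment> \<open>For either order of multiplication the trace changes by p and, once p = 0, the
    sum of the principal 2 by 2 minors changes by -f q.\<close>
  have pf: "p = 0" "f * q = 0"
    using assms by (auto simp: g charpoly_matrix3 algebra_simps)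
  \<comment> \<open>If f = 0 the second row is (0,e,0); otherwise q = 0 and the first column is
    (a,0,0).\<close>
  have "poly (charpoly g) (if f = 0 then e else a) = 0"
    using pf by (auto simp: g charpoly_matrix3 algebra_simps)
  then show ?thesis by blast
qed

section \<open>Transfer from companion matrices to all matrices without eigenvalue\<close>

lemma companion3_conj_by:
  fixes g :: "'a::field^3^3"
  assumes "det g \<noteq> 0" "\<nexists>x. poly (charpoly g) x = 0"
  obtains a b q where "det q \<noteq> 0" "g = conj_by q (companion3 a b (det g))"
    "\<nexists>x. poly (charpoly (companion3 a b (det g))) x = 0"
proof -
  obtain a b where ab: "gl_conj (companion3 a b (det g)) g"
    using gl_conj_companion3[OF assms] .
  moreover have "\<nexists>x. poly (charpoly (companion3 a b (det g))) x = 0"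
    using gl_conj_charpoly(1)[OF ab] assms by simp
  ultimately show ?thesis using that by (elim gl_conjE)
qed

lemma no_root_square_transvection:
  fixes g :: "'a::field^3^3"
  assumes "det g \<noteq> 0" "\<nexists>x. poly (charpoly g) x = 0" "det g ^ 2 = 1"
  shows "\<exists>t y. sl_conj t (transvection 1 2 1) \<and> sl_conj g y \<and> t = g ** y"
proof -
  obtain a b q where q: "det q \<noteq> 0" and g: "g = conj_by q (companion3 a b (det g))"
    and root: "\<nexists>x. poly (charpoly (companion3 a b (det g))) x = 0"
    using companion3_conj_by[OF assms(1,2)] .
  obtain t y where ty: "sl_conj t (transvection 1 2 1)" "sl_conj (companion3 a b (det g)) y"
    "t = companion3 a b (det g) ** y"
    using companion3_square_transvection[OF assms(3) root] by blast
  have "conj_by q t = g ** conj_by q y" by (subst g) (simp add: ty(3) conj_by_mult[OF q])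
  moreover have "sl_conj g (conj_by q y)" by (subst g) (rule sl_conj_conj_by[OF q ty(2)])
  ultimately show ?thesis using sl_conj_transvection_conj_by[OF q ty(1)] by blast
qed

lemma no_root_cube_transvection:
  fixes g :: "'a::field^3^3"
  assumes "det g \<noteq> 0" "\<nexists>x. poly (charpoly g) x = 0" "det g ^ 3 = 1" "det g \<noteq> - 1"
  shows "\<exists>t y z. sl_conj t (transvection 1 2 1) \<and> sl_conj g y \<and> sl_conj g z \<and> t = g ** y ** z"
proof -
  obtain a b q where q: "det q \<noteq> 0" and g: "g = conj_by q (companion3 a b (det g))"
    and root: "\<nexists>x. poly (charpoly (companion3 a b (det g))) x = 0"
    using companion3_conj_by[OF assms(1,2)] .
  obtain t y z where tyz: "sl_conj t (transvection 1 2 1)" "sl_conj (companion3 a b (det g)) y"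
    "sl_conj (companion3 a b (det g)) z" "t = companion3 a b (det g) ** y ** z"
    using companion3_cube_transvection[OF assms(3,4) root] by blast
  have "conj_by q t = g ** conj_by q y ** conj_by q z"
    by (subst g) (simp add: tyz(4) conj_by_mult[OF q])
  moreover have "sl_conj g (conj_by q y)" "sl_conj g (conj_by q z)"
    by (subst g, rule sl_conj_conj_by[OF q], rule tyz)+
  ultimately show ?thesis using sl_conj_transvection_conj_by[OF q tyz(1)] by blast
qed

lemma no_root_unipotent:
  fixes g :: "'a::field^3^3"
  assumes "det g \<noteq> 0" "\<nexists>x. poly (charpoly g) x = 0"
  shows "\<exists>M y. sl_conj g y \<and> g = M ** y \<and> M \<noteq> mat 1 \<and> poly (charpoly M) 1 = 0"
proof -
  obtain a b q where q: "det q \<noteq> 0" and g: "g = conj_by q (companion3 a b (det g))"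
    using companion3_conj_by[OF assms] .
  obtain M y where M: "sl_conj (companion3 a b (det g)) y" "companion3 a b (det g) = M ** y"
    "M \<noteq> mat 1" "poly (charpoly M) 1 = 0"
    using companion3_unipotent[OF assms(1)] by blast
  have "g = conj_by q M ** conj_by q y" by (subst g) (simp add: M(2) conj_by_mult[OF q])
  moreover have "sl_conj g (conj_by q y)" by (subst g) (rule sl_conj_conj_by[OF q M(1)])
  moreover have "conj_by q M \<noteq> mat 1"
    using conj_by_cancel[OF q, of M "mat 1"] M(3) by (auto simp: conj_by_mat[OF q])
  moreover have "det (M ** y) \<noteq> 0" using assms(1) by (simp flip: M(2))
  then have "det M \<noteq> 0" by (simp add: det_mul)
  then have "poly (charpoly (conj_by q M)) 1 = 0"
    using gl_conj_charpoly(1)[OF gl_conj_conj_by[OF q]] M(4) by simp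
  ultimately show ?thesis by blast
qed

subsection \<open>Products of classes\<close>

declare transvection_matrix3 [simp del]

lemma det_transvection: "det (transvection 1 2 a) = 1"
  by (simp add: transvection_matrix3)

text \<open>Thus T is closed under inversion, and the inverse of a class other than T cannot contain
  the transvection either.\<close>

lemma transvection_inverse_sl_conj:
  fixes t :: "'a::field^3^3"
  defines "t \<equiv> transvection 1 2 1"
  shows "sl_conj (inv\<^bsub>GL3\<^esub> t) t"
proof -
  have "transvection 1 2 (- 1) ** t = mat 1"
    by (simp add: t_def transvection_matrix3 mat_1_matrix3)
  then have "inv\<^bsub>GL3\<^esub> t = transvection 1 2 (- 1)"
    by (intro GL3.inv_equality) (simp_all add: t_def carrier_GL3_iff det_transvection)
  moreover have "gl_conj (transvection 1 2 (- 1)) t"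
    using rank_one_gl_conj_transvection[of 1 0 0 "- 1" 0 0]
    by (simp add: t_def transvection_matrix3)
  ultimately show ?thesis unfolding t_def by (simp add: gl_conj_transvection_imp_sl_conj)
qed

lemma conj_class_transvection_subset:
  assumes "subgroup H GL3" "E3 \<subseteq> H" "conj_closed H S" "sl_conj t (transvection 1 2 1)" "t \<in> S"
  shows "conj_class H (transvection 1 2 1) \<subseteq> S"
proof -
  have "transvection 1 2 1 \<in> conj_class H t" by (rule sl_conj_mem_conj_class[OF assms(1,2,4)])
  then have "transvection 1 2 1 \<in> S" using assms(3,5) by (auto simp: conj_closed_def)
  then show ?thesis using conj_class_subset_iff[OF assms(1,3)] by simp
qed

lemma mult_inv_mem_set_mult:
  assumes "M = t ** y" "M \<in> R" "y \<in> carrier GL3" "inv\<^bsub>GL3\<^esub> y \<in> S"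
  shows "t \<in> R <#>\<^bsub>GL3\<^esub> S"
proof -
  have "t = M ** inv\<^bsub>GL3\<^esub> y"
    unfolding assms(1) matrix_mul_assoc[symmetric] by (simp add: inv_GL3_mult[OF assms(3)])
  then show ?thesis using assms(2,4) by (auto simp: set_mult_def)
qed

text \<open>The inverse of c e is the inverse of e times the inverse of c. Hence a quotient of two
  elements of C D, with D the inverse class of C, lies in C D C D.\<close>

lemma conj_class_times_inverse_closed:
  assumes "subgroup H GL3" "g \<in> carrier GL3"
    and "x \<in> conj_class H g <#>\<^bsub>GL3\<^esub> conj_class H (inv\<^bsub>GL3\<^esub> g)"
  shows "inv\<^bsub>GL3\<^esub> x \<in> conj_class H g <#>\<^bsub>GL3\<^esub> conj_class H (inv\<^bsub>GL3\<^esub> g)"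
proof -
  obtain c e where x: "c \<in> conj_class H g" "e \<in> conj_class H (inv\<^bsub>GL3\<^esub> g)" "x = c ** e"
    using assms(3) by (auto simp: set_mult_def)
  have car: "c \<in> carrier GL3" "e \<in> carrier GL3"
    using x conj_class_closed[OF assms(1)] assms(2) by blast+
  then have "inv\<^bsub>GL3\<^esub> x = inv\<^bsub>GL3\<^esub> e ** inv\<^bsub>GL3\<^esub> c"
    using GL3.inv_mult_group[of c e] by (simp add: x(3))
  moreover have "inv\<^bsub>GL3\<^esub> e \<in> conj_class H g"
    using x(2) mem_conj_class_inv_iff[OF assms(1,2) car(2)] by blast
  moreover have "inv\<^bsub>GL3\<^esub> c \<in> conj_class H (inv\<^bsub>GL3\<^esub> g)"
    by (rule inv_mem_conj_class[OF assms(1,2) x(1)])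
  ultimately show ?thesis by (auto simp: set_mult_def)
qed

text \<open>Otherwise some z in the class of g and its product with the transvection, on one of the
  two sides, would both lie in that class and share a characteristic polynomial, which forces a
  root.\<close>

lemma transvection_notin_class_times_inverse:
  fixes g :: "'a::field^3^3"
  assumes H: "subgroup H GL3" and g: "g \<in> carrier GL3"
    and root: "\<nexists>x. poly (charpoly g) x = 0"
  shows "transvection 1 2 1 \<notin> conj_class H g <#>\<^bsub>GL3\<^esub> conj_class H (inv\<^bsub>GL3\<^esub> g)"
    and "transvection 1 2 1 \<notin> conj_class H (inv\<^bsub>GL3\<^esub> g) <#>\<^bsub>GL3\<^esub> conj_class H g"
proof -
  let ?t = "transvection 1 2 1 :: 'a^3^3"
  have *: False if "z \<in> conj_class H g" "?t ** z \<in> conj_class H g \<or> z ** ?t \<in> conj_class H g" for z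
    using that charpoly_mem_conj_class[OF H g] transvection_mult_charpoly[of z] root by metis
  have inv: "inv\<^bsub>GL3\<^esub> y \<in> conj_class H g" "y \<in> carrier GL3"
    if "y \<in> conj_class H (inv\<^bsub>GL3\<^esub> g)" for y
  proof -
    show "y \<in> carrier GL3" using that conj_class_closed[OF H, of "inv\<^bsub>GL3\<^esub> g"] g by auto
    then show "inv\<^bsub>GL3\<^esub> y \<in> conj_class H g" using that mem_conj_class_inv_iff[OF H g] by blast
  qed
  show "?t \<notin> conj_class H g <#>\<^bsub>GL3\<^esub> conj_class H (inv\<^bsub>GL3\<^esub> g)"
  proof
    assume "?t \<in> conj_class H g <#>\<^bsub>GL3\<^esub> conj_class H (inv\<^bsub>GL3\<^esub> g)"
    then obtain x y where xy: "x \<in> conj_class H g" "y \<in> conj_class H (inv\<^bsub>GL3\<^esub> g)" "?t = x ** y"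
      by (auto simp: set_mult_def)
    have "?t ** inv\<^bsub>GL3\<^esub> y = x ** (y ** inv\<^bsub>GL3\<^esub> y)" by (simp only: xy(3) matrix_mul_assoc)
    then have "?t ** inv\<^bsub>GL3\<^esub> y = x" by (simp add: inv_GL3_mult inv(2)[OF xy(2)])
    then show False using *[OF inv(1)[OF xy(2)]] xy(1) by simp
  qed
  show "?t \<notin> conj_class H (inv\<^bsub>GL3\<^esub> g) <#>\<^bsub>GL3\<^esub> conj_class H g"
  proof
    assume "?t \<in> conj_class H (inv\<^bsub>GL3\<^esub> g) <#>\<^bsub>GL3\<^esub> conj_class H g"
    then obtain x y where xy: "x \<in> conj_class H (inv\<^bsub>GL3\<^esub> g)" "y \<in> conj_class H g" "?t = x ** y"
      by (auto simp: set_mult_def)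
    have "inv\<^bsub>GL3\<^esub> x ** ?t = (inv\<^bsub>GL3\<^esub> x ** x) ** y" by (simp only: xy(3) matrix_mul_assoc)
    then have "inv\<^bsub>GL3\<^esub> x ** ?t = y" by (simp add: inv_GL3_mult inv(2)[OF xy(1)])
    then show False using *[OF inv(1)[OF xy(1)]] xy(2) by simp
  qed
qed

lemma transvection_notin_other_class:
  assumes "subgroup H GL3" "E3 \<subseteq> H" "g \<in> carrier GL3"
    and "conj_class H g \<noteq> conj_class H (transvection 1 2 1)"
  shows "transvection 1 2 1 \<notin> conj_class H g" "transvection 1 2 1 \<notin> conj_class H (inv\<^bsub>GL3\<^esub> g)"
proof -
  let ?t = "transvection 1 2 1"
  have car: "?t \<in> carrier GL3" by (simp add: carrier_GL3_iff det_transvection)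
  show "?t \<notin> conj_class H g" using conj_class_eq[OF assms(1)] assms(4) by metis
  show "?t \<notin> conj_class H (inv\<^bsub>GL3\<^esub> g)"
  proof
    assume "?t \<in> conj_class H (inv\<^bsub>GL3\<^esub> g)"
    then have "inv\<^bsub>GL3\<^esub> ?t \<in> conj_class H g"
      using mem_conj_class_inv_iff[OF assms(1,3) car] by blast
    moreover have "?t \<in> conj_class H (inv\<^bsub>GL3\<^esub> ?t)"
      by (rule sl_conj_mem_conj_class[OF assms(1,2) transvection_inverse_sl_conj])
    ultimately have "?t \<in> conj_class H g" using conj_class_trans[OF assms(1)] by blast
    then show False using \<open>?t \<notin> conj_class H g\<close> by blast
  qed
qed

lemma short_sign_list_cases:
  assumes "length is < 4" "is \<noteq> []" "set is \<subseteq> {1, -1 :: int}"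
  obtains i where "is = [i]" "i \<in> {1, -1}"
    | i j where "is = [i, j]" "i \<in> {1, -1}" "j \<in> {1, -1}"
    | i j k where "is = [i, j, k]" "i \<in> {1, -1}" "j \<in> {1, -1}" "k \<in> {1, -1}"
proof -
  consider "length is = 1" | "length is = 2" | "length is = 3" 
    using assms(1,2) by (cases "length is") force+
  then show ?thesis
    using assms(3) that by cases (auto simp: length_Suc_conv numeral_eq_Suc)
qed

section \<open>From matrix factorizations to the values of m(C)\<close>

theorem theorem29:
  fixes H T C D :: "('k::field^3^3) set" and g :: "'k^3^3"
  assumes "subgroup H GL3" and "E3 \<subseteq> H"
    and "T = conj_class H (transvection 1 2 1)"
    and "g \<in> carrier GL3" and "g \<notin> group_center GL3"
    and "C = conj_class H g" and "D = conj_class H (inv\<^bsub>GL3\<^esub> g)"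
  shows "(C = T \<longrightarrow> class_m H g = 1) \<and>
    (C \<noteq> T \<and> (\<exists>x. poly (charpoly g) x = 0) \<longrightarrow>
       class_m H g = 2 \<and> T \<subseteq> C <#>\<^bsub>GL3\<^esub> D) \<and>
    (C \<noteq> T \<and> (\<nexists>x. poly (charpoly g) x = 0) \<and> (det g)^2 = 1 \<longrightarrow>
       class_m H g = 2 \<and> T \<subseteq> C <#>\<^bsub>GL3\<^esub> C) \<and>
    (C \<noteq> T \<and> (\<nexists>x. poly (charpoly g) x = 0) \<and> (det g)^2 \<noteq> 1 \<and> (det g)^3 = 1 \<longrightarrow>
       class_m H g = 3 \<and> T \<subseteq> C <#>\<^bsub>GL3\<^esub> C <#>\<^bsub>GL3\<^esub> C) \<and>
    (C \<noteq> T \<and> (\<nexists>x. poly (charpoly g) x = 0) \<and> (det g)^2 \<noteq> 1 \<and> (det g)^3 \<noteq> 1 \<longrightarrow>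
       class_m H g = 4 \<and> T \<subseteq> C <#>\<^bsub>GL3\<^esub> D <#>\<^bsub>GL3\<^esub> C <#>\<^bsub>GL3\<^esub> D)"
proof -
  let ?t = "transvection 1 2 1 :: 'k^3^3"
  note H = assms(1) and gc = assms(4)
  have det: "det g \<noteq> 0" using gc by (simp add: carrier_GL3_iff)
  have gC: "g \<in> C" using conj_class_self[OF H] assms(6) by blast
  have CD: "C \<subseteq> carrier GL3" "D \<subseteq> carrier GL3"
    using conj_class_closed[OF H] gc assms(6,7) by simp_all
  have closed: "conj_closed H C" "conj_closed H D"
    using conj_closed_conj_class[OF H] gc assms(6,7) by simp_all
  have sl: "y \<in> C" if "sl_conj g y" for y
    using sl_conj_mem_conj_class[OF H assms(2) that] assms(6) by blast
  have inv: "inv\<^bsub>GL3\<^esub> y \<in> D" if "y \<in> C" for y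
    using inv_mem_conj_class[OF H gc] that assms(6,7) by blast
  have mem: "T \<subseteq> S" if "conj_closed H S" "sl_conj t ?t" "t \<in> S" for S t
    using conj_class_transvection_subset[OF H assms(2) that] assms(3) by blast
  have m: "class_m H g = n"
    if "n > 0" "length is = n" "set is \<subseteq> {1, -1}" "T \<subseteq> signed_class_prod H g is"
      "\<And>is. length is < n \<Longrightarrow> is \<noteq> [] \<Longrightarrow> set is \<subseteq> {1, -1} \<Longrightarrow> ?t \<notin> signed_class_prod H g is"
    for n "is"
  proof (rule class_m_eqI[OF H gc that(1-3) _ that(5)])
    show "?t \<in> signed_class_prod H g is"
      using that(4) conj_class_self[OF H] assms(3) by blast
  qed
  have single: "is = [1] \<or> is = [-1]" if "length is < 2" "is \<noteq> []" "set is \<subseteq> {1, -1}"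
    for "is" :: "int list"
    using that by (cases "is") auto
  have not1: "?t \<notin> signed_class_prod H g is"
    if "C \<noteq> T" "length is < 2" "is \<noteq> []" "set is \<subseteq> {1, -1}" for "is"
    using single[OF that(2-4)] transvection_notin_other_class[OF H assms(2) gc] that(1)
      assms(3,6) by auto
  have not2: "?t \<notin> C <#>\<^bsub>GL3\<^esub> D" "?t \<notin> D <#>\<^bsub>GL3\<^esub> C" if "\<nexists>x. poly (charpoly g) x = 0"
    using transvection_notin_class_times_inverse[OF H gc that] assms(6,7) by simp_all
  have dets: "(\<Prod>i\<leftarrow>is. if i = 1 then det g else inverse (det g)) = 1"
    if "?t \<in> signed_class_prod H g is" for "is"
    using det_signed_class_prod[OF H gc that] by (simp add: det_transvection)
  \<comment> \<open>With d = \<open>det g\<close>: one factor, or three with mixed signs, would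
    force d = 1; two equal signs force d^2 = 1; three equal signs force d^3 = 1. Two opposite signs
    escape the determinant and are excluded by \<open>not2\<close>. The conditional hypothesis makes
    the fact usable for the bounds 3 and 4 alike.\<close>
  have not3: "?t \<notin> signed_class_prod H g is"
    if "\<nexists>x. poly (charpoly g) x = 0" "(det g)^2 \<noteq> 1" "length is < 4" "length is = 3 \<longrightarrow> (det g)^3 \<noteq> 1"
      "is \<noteq> []" "set is \<subseteq> {1, -1}" for "is"
  proof
    assume t: "?t \<in> signed_class_prod H g is"
    have d: "det g \<noteq> 1" "det g * det g \<noteq> 1" using that(2) by (auto simp: power2_eq_square)
    have d3: "det g * (det g * det g) \<noteq> 1" if "length is = 3"
      using that \<open>length is = 3 \<longrightarrow> (det g)^3 \<noteq> 1\<close> by (simp add: power3_eq_cube mult.assoc)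
    show False
      using that(3,5,6)
    proof (cases rule: short_sign_list_cases)
      case (1 i)
      then show False using dets[OF t] d by (auto simp: inverse_eq_1_iff)
    next
      case (2 i j)
      then consider "i = j" | "is = [1, -1]" | "is = [-1, 1]" by auto
      then show False
      proof cases
        case 1
        then show False using 2 dets[OF t] d
          by (auto simp flip: inverse_mult_distrib simp: inverse_eq_1_iff)
      qed (use t not2[OF that(1)] assms(6,7) in auto)
    next
      case (3 i j k)
      then show False using dets[OF t] d d3 det
        by (auto simp: field_simps)
    qed
  qed
  have "class_m H g = 1" if "C = T"
    by (rule m[of 1 "[1]"]) (use that assms(6) in auto)
  moreover have "class_m H g = 2 \<and> T \<subseteq> C <#>\<^bsub>GL3\<^esub> D" if h: "C \<noteq> T" "poly (charpoly g) x = 0" for x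
  proof -
    have "g \<noteq> mat x"
    proof
      assume "g = mat x"
      moreover have "mat x ** y = y ** mat x" for y :: "'k^3^3"
        by (rule matrix3_exhaust[of y]) (simp add: mat_matrix3 mult.commute)
      ultimately show False using gc assms(5) by (simp add: group_center_def)
    qed
    then obtain t y where t: "sl_conj t ?t" "sl_conj g y" "g = t ** y"
      using root_transvection_times_conj[OF det h(2)] by blast
    have "t \<in> C <#>\<^bsub>GL3\<^esub> D"
      using mult_inv_mem_set_mult[OF t(3) gC _ inv] sl[OF t(2)] CD by blast
    then have "T \<subseteq> C <#>\<^bsub>GL3\<^esub> D" by (rule mem[OF conj_closed_set_mult[OF H closed] t(1)])
    then show ?thesis using m[of 2 "[1, -1]"] not1[OF h(1)] assms(6,7) by simp
  qed
  moreover have "class_m H g = 2 \<and> T \<subseteq> C <#>\<^bsub>GL3\<^esub> C"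
    if h: "C \<noteq> T" "\<nexists>x. poly (charpoly g) x = 0" "(det g)^2 = 1"
  proof -
    obtain t y where t: "sl_conj t ?t" "sl_conj g y" "t = g ** y"
      using no_root_square_transvection[OF det h(2,3)] by blast
    have "t \<in> C <#>\<^bsub>GL3\<^esub> C" using t(3) sl[OF t(2)] gC by (auto simp: set_mult_def)
    then have "T \<subseteq> C <#>\<^bsub>GL3\<^esub> C"
      by (rule mem[OF conj_closed_set_mult[OF H closed(1) closed(1)] t(1)])
    then show ?thesis using m[of 2 "[1, 1]"] not1[OF h(1)] assms(6) by simp
  qed
  moreover have "class_m H g = 3 \<and> T \<subseteq> C <#>\<^bsub>GL3\<^esub> C <#>\<^bsub>GL3\<^esub> C"
    if h: "\<nexists>x. poly (charpoly g) x = 0" "(det g)^2 \<noteq> 1" "(det g)^3 = 1"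
  proof -
    have "det g \<noteq> -1" using h(2) by auto
    then obtain t y z where t: "sl_conj t ?t" "sl_conj g y" "sl_conj g z" "t = g ** y ** z"
      using no_root_cube_transvection[OF det h(1,3)] by blast
    have "t \<in> C <#>\<^bsub>GL3\<^esub> C <#>\<^bsub>GL3\<^esub> C"
      unfolding set_mult_def using t(4) sl[OF t(2)] sl[OF t(3)] gC by auto
    then have T: "T \<subseteq> C <#>\<^bsub>GL3\<^esub> C <#>\<^bsub>GL3\<^esub> C"
      using mem[OF _ t(1)] conj_closed_set_mult[OF H] closed(1) by blast
    moreover have "signed_class_prod H g [1, 1, 1] = C <#>\<^bsub>GL3\<^esub> C <#>\<^bsub>GL3\<^esub> C"
      using GL3.set_mult_assoc[of C C C] CD assms(6) by simp
    ultimately show ?thesis using m[of 3 "[1, 1, 1]"] not3[OF h(1,2)] by simp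
  qed
  moreover have "class_m H g = 4 \<and> T \<subseteq> C <#>\<^bsub>GL3\<^esub> D <#>\<^bsub>GL3\<^esub> C <#>\<^bsub>GL3\<^esub> D"
    if h: "\<nexists>x. poly (charpoly g) x = 0" "(det g)^2 \<noteq> 1" "(det g)^3 \<noteq> 1"
  proof -
    let ?S = "C <#>\<^bsub>GL3\<^esub> D"
    have S: "conj_closed H ?S" by (rule conj_closed_set_mult[OF H closed])
    \<comment> \<open>\<open>M\<close> lies in C D, is not the identity and has eigenvalue 1, so the
      eigenvalue case applies to it: \<open>M = t ** N\<close> with \<open>N\<close> again in C D,
      and t is the quotient of \<open>M\<close> by \<open>N\<close>.\<close>
    obtain M y where M: "sl_conj g y" "g = M ** y" "M \<noteq> mat 1" "poly (charpoly M) 1 = 0"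
      using no_root_unipotent[OF det h(1)] by blast
    have MS: "M \<in> ?S"
      using mult_inv_mem_set_mult[OF M(2) gC _ inv] sl[OF M(1)] CD by blast
    have "det M \<noteq> 0" using M(2) det by (metis det_mul mult_eq_0_iff)
    then obtain t N where t: "sl_conj t ?t" "sl_conj M N" "M = t ** N"
      using root_transvection_times_conj[OF _ M(4,3)] by blast
    have NS: "N \<in> ?S"
      using sl_conj_mem_conj_class[OF H assms(2) t(2)] S MS unfolding conj_closed_def by blast
    then have "inv\<^bsub>GL3\<^esub> N \<in> ?S" "N \<in> carrier GL3"
      using conj_class_times_inverse_closed[OF H gc] S assms(6,7) unfolding conj_closed_def by blast+
    then have "t \<in> ?S <#>\<^bsub>GL3\<^esub> ?S" using mult_inv_mem_set_mult[OF t(3) MS] by blast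
    then have T: "T \<subseteq> ?S <#>\<^bsub>GL3\<^esub> ?S" by (rule mem[OF conj_closed_set_mult[OF H S S] t(1)])
    \<comment> \<open>The theorem nests products to the left, \<open>signed_class_prod\<close> to
      the right.\<close>
    have assoc: "?S <#>\<^bsub>GL3\<^esub> ?S = C <#>\<^bsub>GL3\<^esub> D <#>\<^bsub>GL3\<^esub> C <#>\<^bsub>GL3\<^esub> D"
      "C <#>\<^bsub>GL3\<^esub> (D <#>\<^bsub>GL3\<^esub> ?S) = ?S <#>\<^bsub>GL3\<^esub> ?S"
      using CD S by (simp_all add: GL3.set_mult_assoc GL3.set_mult_closed conj_closed_def)
    then have "signed_class_prod H g [1, -1, 1, -1] = ?S <#>\<^bsub>GL3\<^esub> ?S"
      using assms(6,7) by simp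
    then show ?thesis using T m[of 4 "[1, -1, 1, -1]"] not3[OF h(1,2)] h(3) assoc(1) by simp
  qed
  ultimately show ?thesis by blast
qed

end
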